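(* Let $P$ be a commutative Noetherian ring and let $$F:\quad 0\to F_4\xrightarrow{d_4}F_3\xrightarrow{d_3}F_2\xrightarrow{d_2}F_1\xrightarrow{d_1}F_0=P$$ be a length four resolution of a cyclic $P$-module by finitely generated free $P$-modules. Assume that $F_4$ has rank one and that the complexes $F$ and $F^\vee$ are isomorphic, where $(-)^\vee=\operatorname{Hom}_P(-,F_4)$. Then $F$ has the structure of a $\mathrm{DG}\Gamma$-algebra which exhibits Poincaré duality.
   Context: The complex $F^\vee$ is $0\to F_0^\vee\xrightarrow{d_1^\vee}F_1^\vee\xrightarrow{d_2^\vee}F_2^\vee\xrightarrow{d_3^\vee}F_3^\vee\xrightarrow{d_4^\vee}F_4^\vee$, with $F_{4-i}^\vee$ in homological position $i$. A DG-algebra over $P$ is a complex $(F,d)$ of finitely generated free $P$-modules $\cdots\xrightarrow{d_2}F_1\xrightarrow{d_1}F_0=P$ together with a unitary, associative multiplication $F\otimes_PF\to F$ satisfying, for $x_\ell\in F_\ell$: (a) $F_iF_j\subseteq F_{i+j}$; (b) $d_{i+j}(x_ix_j)=d_i(x_i)x_j+(-1)^ix_id_j(x_j)$; (c) $x_ix_j=(-1)^{ij}x_jx_i$; (d) $x_i^2=0$ when $i$ is odd. A $\mathrm{DG}\Gamma$-algebra (DG-algebra with divided powers) is a DG-algebra $F$ such that for each positive even $i$ and each $x_i\in F_i$ there is a family of elements $\{x_i^{(k)}\}_{k\ge 0}$, $x_i^{(k)}\in F_{ik}$, satisfying the divided power axioms and also $d_{ik}(x_i^{(k)})=d_i(x_i)\,x_i^{(k-1)}$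 for $k\ge1$. The divided power axioms are (for homogeneous elements): $x^{(0)}=1$, $x^{(1)}=x$; $x^{(h)}x^{(k)}=\binom{h+k}{h}x^{(h+k)}$; $(x+y)^{(k)}=\sum_{i+j=k}x^{(i)}y^{(j)}$ for $x,y$ of the same positive even degree; for $k\ge2$, $(xy)^{(k)}=0$ if $x,y$ both have odd degree, and $(xy)^{(k)}=x^ky^{(k)}$ if $x$ has even degree and $y$ has positive even degree; $(x^{(h)})^{(k)}=\frac{(hk)!}{k!\,(h!)^k}x^{(hk)}$ for $h\geq 1$. A DG-algebra $F$ exhibits Poincaré duality if there is an integer $m$ such that $F_i=0$ for $m<i$, $F_m\cong P$, and for each integer $i$ the multiplication map $F_i\otimes_PF_{m-i}\to F_m$ is a perfect pairing, i.e. the induced maps $F_i\to\operatorname{Hom}_P(F_{m-i},F_m)$ and $F_{m-i}\to\operatorname{Hom}_P(F_i,F_m)$ are isomorphisms. *)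

theory Defs
  imports Complex_Main "HOL-Library.Function_Algebras"
begin

text \<open>The ideals of a commutative ring are its submodules as a module over itself.\<close>

definition noetherian :: "'p::comm_ring_1 itself \<Rightarrow> bool" where
  "noetherian _ \<longleftrightarrow>
     (\<forall>I::'p set. module.subspace (*) I \<longrightarrow> (\<exists>S. finite S \<and> module.span (*) S = I))"

definition free_of_rank ::
  "('p::comm_ring_1 \<Rightarrow> 'm::ab_group_add \<Rightarrow> 'm) \<Rightarrow> 'm set \<Rightarrow> nat \<Rightarrow> bool" where
  "free_of_rank scale M n \<longleftrightarrow>
     (\<exists>B. finite B \<and> card B = n \<and> \<not> module.dependent scale B \<and> module.span scale B = M)"

definition linear_between ::
  "('p \<Rightarrow> 'a \<Rightarrow> 'a) \<Rightarrow> 'a::ab_group_add set \<Rightarrow> ('p \<Rightarrow> 'b \<Rightarrow> 'b) \<Rightarrow> 'b::ab_group_add set \<Rightarrow>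
   ('a \<Rightarrow> 'b) \<Rightarrow> bool" where
  "linear_between s A t B f \<longleftrightarrow>
     f ` A \<subseteq> B \<and> (\<forall>x\<in>A. \<forall>y\<in>A. f (x + y) = f x + f y) \<and> (\<forall>r. \<forall>x\<in>A. f (s r x) = t r (f x))"

definition module_iso ::
  "('p \<Rightarrow> 'a \<Rightarrow> 'a) \<Rightarrow> 'a::ab_group_add set \<Rightarrow> ('p \<Rightarrow> 'b \<Rightarrow> 'b) \<Rightarrow> 'b::ab_group_add set \<Rightarrow>
   ('a \<Rightarrow> 'b) \<Rightarrow> bool" where
  "module_iso s A t B f \<longleftrightarrow> linear_between s A t B f \<and> bij_betw f A B"

text \<open>The module of homomorphisms \<open>A \<rightarrow> B\<close>, with the pointwise operations. A homomorphism is
  represented by its extension by zero off \<open>A\<close>, so that it is determined by its values on \<open>A\<close>.\<close>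

definition extend0 :: "'a set \<Rightarrow> ('a \<Rightarrow> 'b::zero) \<Rightarrow> 'a \<Rightarrow> 'b" where
  "extend0 A f = (\<lambda>x. if x \<in> A then f x else 0)"

definition Hom ::
  "('p \<Rightarrow> 'm \<Rightarrow> 'm) \<Rightarrow> 'm::ab_group_add set \<Rightarrow> 'm set \<Rightarrow> ('m \<Rightarrow> 'm) set" where
  "Hom s A B = {f. linear_between s A s B f \<and> (\<forall>x. x \<notin> A \<longrightarrow> f x = 0)}"

definition Hom_scale :: "('p \<Rightarrow> 'm \<Rightarrow> 'm) \<Rightarrow> 'p \<Rightarrow> ('m \<Rightarrow> 'm) \<Rightarrow> ('m \<Rightarrow> 'm)" where
  "Hom_scale s r f = (\<lambda>x. s r (f x))"

text \<open>A complex is given by its modules \<open>F i\<close>, all of them submodules of one ambient module, and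
  by maps \<open>d i : F i \<rightarrow> F (i - 1)\<close>, for every integer \<open>i\<close>. No relation is imposed between the
  submodules for distinct \<open>i\<close>; only the values of \<open>d i\<close> on \<open>F i\<close> matter.\<close>

definition complexes_isomorphic ::
  "('p \<Rightarrow> 'a \<Rightarrow> 'a) \<Rightarrow> (int \<Rightarrow> 'a::ab_group_add set) \<Rightarrow> (int \<Rightarrow> 'a \<Rightarrow> 'a) \<Rightarrow>
   ('p \<Rightarrow> 'b \<Rightarrow> 'b) \<Rightarrow> (int \<Rightarrow> 'b::ab_group_add set) \<Rightarrow> (int \<Rightarrow> 'b \<Rightarrow> 'b) \<Rightarrow> bool" where
  "complexes_isomorphic s F d t G e \<longleftrightarrow>
     (\<exists>\<phi>. \<forall>i. module_iso s (F i) t (G i) (\<phi> i) \<and> (\<forall>x\<in>F i. \<phi> (i - 1) (d i x) = e i (\<phi> i x)))"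

text \<open>The complex \<open>Hom (F, F n)\<close>, with the dual of \<open>F (n - i)\<close> in position \<open>i\<close>. Its differential
  from position \<open>i\<close> to position \<open>i - 1\<close> is composition with
  \<open>d (n - i + 1) : F (n - i + 1) \<rightarrow> F (n - i)\<close>, without a sign.\<close>

definition dual_modules ::
  "('p \<Rightarrow> 'm \<Rightarrow> 'm) \<Rightarrow> (int \<Rightarrow> 'm::ab_group_add set) \<Rightarrow> int \<Rightarrow> int \<Rightarrow> ('m \<Rightarrow> 'm) set" where
  "dual_modules s F n i = Hom s (F (n - i)) (F n)"

definition dual_diff ::
  "(int \<Rightarrow> 'm::ab_group_add set) \<Rightarrow> (int \<Rightarrow> 'm \<Rightarrow> 'm) \<Rightarrow> int \<Rightarrow> int \<Rightarrow> ('m \<Rightarrow> 'm) \<Rightarrow> ('m \<Rightarrow> 'm)" where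
  "dual_diff F d n i f = extend0 (F (n - i + 1)) (\<lambda>x. f (d (n - i + 1) x))"

text \<open>A complex \<open>\<dots> \<rightarrow> F 1 \<rightarrow> F 0 = P\<close> of finitely generated free \<open>P\<close>-modules, where \<open>P\<close> is the
  type of scalars. The equality \<open>F 0 = P\<close> is the identification of \<open>r\<close> with \<open>r *s e\<close>, so that the
  element \<open>e\<close> of \<open>F 0\<close> is the identity of \<open>P\<close>.\<close>

locale free_complex = module scale
  for scale :: "'p::comm_ring_1 \<Rightarrow> 'm::ab_group_add \<Rightarrow> 'm" (infixr \<open>*s\<close> 75) +
  fixes F :: "int \<Rightarrow> 'm set"
    and d :: "int \<Rightarrow> 'm \<Rightarrow> 'm"
    and e :: 'm
  assumes free: "\<exists>n. free_of_rank scale (F i) n"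
    and F_neg: "i < 0 \<Longrightarrow> F i = {0}"
    and F_0: "module_iso (*) UNIV scale (F 0) (\<lambda>r. r *s e)"
    and d_linear: "linear_between scale (F i) scale (F (i - 1)) (d i)"
    and d_d: "x \<in> F i \<Longrightarrow> d (i - 1) (d i x) = 0"

text \<open>The module which is resolved is the cokernel of \<open>d 1\<close>. It is cyclic because \<open>F 0 = P\<close>, and
  every resolution of a cyclic module by a complex with \<open>F 0 = P\<close> is of this form.\<close>

locale free_resolution = free_complex +
  assumes exact: "0 < i \<Longrightarrow> {x \<in> F i. d i x = 0} = d (i + 1) ` F (i + 1)"

text \<open>The product of \<open>x \<in> F i\<close> and \<open>y \<in> F j\<close> is \<open>mul i j x y\<close>.\<close>

locale dg_algebra = free_complex +
  fixes mul :: "int \<Rightarrow> int \<Rightarrow> 'b \<Rightarrow> 'b \<Rightarrow> 'b"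
  assumes mul_linear_left:
      "y \<in> F j \<Longrightarrow> linear_between scale (F i) scale (F (i + j)) (\<lambda>x. mul i j x y)"
    and mul_linear_right:
      "x \<in> F i \<Longrightarrow> linear_between scale (F j) scale (F (i + j)) (mul i j x)"
    and mul_unit_left: "x \<in> F i \<Longrightarrow> mul 0 i e x = x"
    and mul_unit_right: "x \<in> F i \<Longrightarrow> mul i 0 x e = x"
    and mul_assoc: "\<lbrakk>x \<in> F i; y \<in> F j; z \<in> F k\<rbrakk> \<Longrightarrow>
      mul (i + j) k (mul i j x y) z = mul i (j + k) x (mul j k y z)"
    and leibniz: "\<lbrakk>x \<in> F i; y \<in> F j\<rbrakk> \<Longrightarrow>
      d (i + j) (mul i j x y) =
        mul (i - 1) j (d i x) y + (if even i then 1 else - 1) *s mul i (j - 1) x (d j y)"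
    and graded_commute: "\<lbrakk>x \<in> F i; y \<in> F j\<rbrakk> \<Longrightarrow>
      mul i j x y = (if even (i * j) then 1 else - 1) *s mul j i y x"
    and odd_square: "\<lbrakk>odd i; x \<in> F i\<rbrakk> \<Longrightarrow> mul i i x x = 0"
begin

text \<open>The \<open>k\<close>-th power of \<open>x \<in> F i\<close>, an element of \<open>F (i * int k)\<close>.\<close>

primrec pow :: "int \<Rightarrow> nat \<Rightarrow> 'b \<Rightarrow> 'b" where
  "pow i 0 x = e"
| "pow i (Suc k) x = mul i (i * int k) x (pow i k x)"

end

text \<open>For \<open>i\<close> positive and even, \<open>dpow i k x\<close> is the \<open>k\<close>-th divided power of \<open>x \<in> F i\<close>.\<close>

locale dg_gamma_algebra = dg_algebra +
  fixes dpow :: "int \<Rightarrow> nat \<Rightarrow> 'b \<Rightarrow> 'b"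
  assumes dpow_closed: "\<lbrakk>0 < i; even i; x \<in> F i\<rbrakk> \<Longrightarrow> dpow i k x \<in> F (i * int k)"
    and dpow_0: "\<lbrakk>0 < i; even i; x \<in> F i\<rbrakk> \<Longrightarrow> dpow i 0 x = e"
    and dpow_1: "\<lbrakk>0 < i; even i; x \<in> F i\<rbrakk> \<Longrightarrow> dpow i 1 x = x"
    and dpow_mult: "\<lbrakk>0 < i; even i; x \<in> F i\<rbrakk> \<Longrightarrow>
      mul (i * int h) (i * int k) (dpow i h x) (dpow i k x) =
        of_nat ((h + k) choose h) *s dpow i (h + k) x"
    and dpow_add: "\<lbrakk>0 < i; even i; x \<in> F i; y \<in> F i\<rbrakk> \<Longrightarrow>
      dpow i k (x + y) =
        (\<Sum>j\<le>k. mul (i * int j) (i * int (k - j)) (dpow i j x) (dpow i (k - j) y))"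
    and dpow_odd_product: "\<lbrakk>2 \<le> k; 0 < i; 0 < j; odd i; odd j; x \<in> F i; y \<in> F j\<rbrakk> \<Longrightarrow>
      dpow (i + j) k (mul i j x y) = 0"
    and dpow_even_product: "\<lbrakk>2 \<le> k; 0 \<le> i; 0 < j; even i; even j; x \<in> F i; y \<in> F j\<rbrakk> \<Longrightarrow>
      dpow (i + j) k (mul i j x y) = mul (i * int k) (j * int k) (pow i k x) (dpow j k y)"
    and dpow_dpow: "\<lbrakk>0 < i; even i; 1 \<le> h; x \<in> F i\<rbrakk> \<Longrightarrow>
      dpow (i * int h) k (dpow i h x) =
        of_nat (fact (h * k) div (fact k * fact h ^ k)) *s dpow i (h * k) x"
    and d_dpow: "\<lbrakk>0 < i; even i; 1 \<le> k; x \<in> F i\<rbrakk> \<Longrightarrow>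
      d (i * int k) (dpow i k x) = mul (i - 1) (i * int (k - 1)) (d i x) (dpow i (k - 1) x)"

text \<open>The last two conditions say that the pairing of \<open>F i\<close> and \<open>F (m - i)\<close> into \<open>F m\<close> is perfect.\<close>

definition poincare_duality ::
  "('p::comm_ring_1 \<Rightarrow> 'm \<Rightarrow> 'm) \<Rightarrow> (int \<Rightarrow> 'm::ab_group_add set) \<Rightarrow>
   (int \<Rightarrow> int \<Rightarrow> 'm \<Rightarrow> 'm \<Rightarrow> 'm) \<Rightarrow> bool" where
  "poincare_duality s F mul \<longleftrightarrow>
     (\<exists>m. (\<forall>i>m. F i = {0}) \<and>
          (\<exists>f. module_iso (*) UNIV s (F m) f) \<and>
          (\<forall>i. module_iso s (F i) (Hom_scale s) (Hom s (F (m - i)) (F m))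
                 (\<lambda>x. extend0 (F (m - i)) (\<lambda>y. mul i (m - i) x y)) \<and>
               module_iso s (F (m - i)) (Hom_scale s) (Hom s (F i) (F m))
                 (\<lambda>y. extend0 (F i) (\<lambda>x. mul i (m - i) x y))))"

end

theory Submission
  imports Defs
begin

text \<open>
The isomorphism \<open>\<phi>\<close> of \<open>F\<close> with its dual is used in two ways. It shows that the dual complex is
exact, and in degrees \<open>0\<close> and \<open>1\<close> it provides, after multiplication by a unit of \<open>P\<close>, a perfect
pairing \<open>pr\<close> of \<open>F 1\<close> and \<open>F 3\<close> into \<open>F 4\<close> with \<open>pr x (d t) = (d x) t\<close> (\<open>exists_dual_pairing\<close>).
The multiplication is built around this pairing, which is made to be the product of \<open>F 1\<close> and
\<open>F 3\<close>; in this way duality in degree \<open>1\<close> holds by construction, whereas a multiplication chosen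
without regard to \<open>\<phi>\<close> would in general induce only a homotopy equivalence of \<open>F\<close> with its dual.

The products of \<open>F 1\<close> with \<open>F 1\<close> and with \<open>F 2\<close> are found by lifting along the exact complex
\<open>F\<close>, with values chosen on bases. The Leibniz rule then dictates a product of \<open>F 1\<close> and \<open>F 3\<close>.
It differs from \<open>pr\<close> by functionals of \<open>F 3\<close> which vanish on the image of \<open>d 4\<close>. These factor
through \<open>d 3\<close>, as the dual complex is exact, and so can be absorbed into the product of \<open>F 1\<close>
and \<open>F 2\<close> (\<open>exists_product_1_2\<close>).

Associativity comes down to \<open>x (x y) = 0\<close> for \<open>x\<close> and \<open>y\<close> of degree \<open>1\<close>. To achieve it, let \<open>H\<close>
be an alternating trilinear map from \<open>F 1\<close> to \<open>F 3\<close> such that \<open>d (H x y z)\<close> is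
\<open>(d x) y z - (d y) x z + (d z) x y\<close>. Then \<open>x (y z) - H x y z\<close> is a cycle, hence \<open>d (\<rho> x y z)\<close>
for some \<open>\<rho> x y z\<close> in \<open>F 4\<close>, and by duality \<open>\<rho> x y z = pr x (\<nu> y z)\<close> for an alternating map \<open>\<nu>\<close>
into \<open>F 3\<close>. Adding \<open>d (\<nu> y z)\<close> to \<open>y z\<close>, and subtracting \<open>\<nu> x (d v)\<close> from \<open>x v\<close> for \<open>v\<close> in
\<open>F 2\<close>, keeps the Leibniz rule and turns \<open>x (y z)\<close> into an alternating function
(\<open>exists_associative_products\<close>).

As \<open>d 4\<close> is injective, the product of two elements of \<open>F 2\<close> and the divided square \<open>dsq v\<close> are
now determined by \<open>d (v w) = (d v) w + (d w) v\<close> and by \<open>d (dsq v) = (d v) v\<close>, without any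
division by \<open>2\<close>, and every remaining identity in degree \<open>4\<close> can be checked after applying \<open>d 4\<close>.
Products and divided powers of degree above \<open>4\<close> vanish. The pairing of \<open>F 2\<close> with itself is
perfect by a five lemma argument from the pairings of \<open>F 1\<close> with \<open>F 3\<close> and of \<open>F 0\<close> with \<open>F 4\<close>
(\<open>m22_perfect\<close>).
\<close>

section \<open>Linear, bilinear and trilinear maps between the modules of a complex\<close>

lemma alternating_double_sum_eq_0:
  fixes f :: "nat \<Rightarrow> nat \<Rightarrow> 'm::ab_group_add"
  assumes "\<And>i. f i i = 0" and "\<And>i j. f j i = - f i j"
  shows "(\<Sum>i<n. \<Sum>j<n. f i j) = 0"
proof (induction n)
  case (Suc n)
  have "(\<Sum>i<n. f i n) + (\<Sum>j<n. f n j) = (\<Sum>i<n. f i n + f n i)"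
    by (simp add: sum.distrib)
  also have "\<dots> = 0"
    using assms(2) by (intro sum.neutral) (metis add.right_inverse)
  finally show ?case
    using Suc assms(1) by (simp add: sum.distrib add.commute)
qed simp

context free_complex
begin

abbreviation lin :: "int \<Rightarrow> int \<Rightarrow> ('m \<Rightarrow> 'm) \<Rightarrow> bool" where
  "lin i j f \<equiv> linear_between scale (F i) scale (F j) f"

definition bil :: "int \<Rightarrow> int \<Rightarrow> int \<Rightarrow> ('m \<Rightarrow> 'm \<Rightarrow> 'm) \<Rightarrow> bool" where
  "bil i j k f \<longleftrightarrow> (\<forall>y\<in>F j. lin i k (\<lambda>x. f x y)) \<and> (\<forall>x\<in>F i. lin j k (f x))"

text \<open>
Generators \<open>b\<close> of \<open>F i\<close> together with linear coordinate functions \<open>X\<close>, such as those of a basis.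
They are enumerated by natural numbers because the lifts of alternating maps need an order on
them.
\<close>

definition coordinates :: "int \<Rightarrow> nat \<Rightarrow> (nat \<Rightarrow> 'm) \<Rightarrow> (nat \<Rightarrow> 'm \<Rightarrow> 'p) \<Rightarrow> bool" where
  "coordinates i n b X \<longleftrightarrow>
     (\<forall>j<n. b j \<in> F i) \<and>
     (\<forall>j<n. \<forall>x\<in>F i. \<forall>y\<in>F i. X j (x + y) = X j x + X j y) \<and>
     (\<forall>j<n. \<forall>r. \<forall>x\<in>F i. X j (r *s x) = r * X j x) \<and>
     (\<forall>x\<in>F i. x = (\<Sum>j<n. X j x *s b j))"

lemma subspace_F: "subspace (F i)"
proof -
  obtain B where "span B = F i"
    using free[of i] unfolding free_of_rank_def by blast
  then show ?thesis
    by (metis subspace_span)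
qed

lemma F_zero [simp]: "0 \<in> F i"
  and F_add: "\<lbrakk>x \<in> F i; y \<in> F i\<rbrakk> \<Longrightarrow> x + y \<in> F i"
  and F_scale: "x \<in> F i \<Longrightarrow> r *s x \<in> F i"
  and F_uminus: "x \<in> F i \<Longrightarrow> - x \<in> F i"
  and F_diff: "\<lbrakk>x \<in> F i; y \<in> F i\<rbrakk> \<Longrightarrow> x - y \<in> F i"
  and F_sum: "(\<And>s. s \<in> S \<Longrightarrow> g s \<in> F i) \<Longrightarrow> sum g S \<in> F i"
  by (rule subspace_0[OF subspace_F] subspace_add[OF subspace_F] subspace_scale[OF subspace_F]
      subspace_neg[OF subspace_F] subspace_diff[OF subspace_F] subspace_sum[OF subspace_F]; assumption)+

lemmas F_closed = F_add F_scale F_uminus F_diff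

lemma coordinates_exist: "\<exists>n b X. coordinates i n b X"
proof -
  obtain n B where B: "finite B" "card B = n" "\<not> dependent B" "span B = F i"
    using free[of i] unfolding free_of_rank_def by blast
  obtain b where b: "bij_betw b {..<n} B"
    using ex_bij_betw_nat_finite[OF B(1)] B(2) by (auto simp: atLeast0LessThan)
  define X where "X = (\<lambda>j x. representation B x (b j))"
  have bB: "b j \<in> B" if "j < n" for j
    using b that by (auto simp: bij_betw_def)
  have "x = (\<Sum>j<n. X j x *s b j)" if "x \<in> F i" for x
  proof -
    have "x = (\<Sum>v\<in>B. representation B x v *s v)"
      using sum_representation_eq[of B x B] B that by auto
    also have "\<dots> = (\<Sum>j<n. X j x *s b j)"
      unfolding X_def using sum.reindex_bij_betw[OF b, of "\<lambda>v. representation B x v *s v"] by simp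
    finally show ?thesis .
  qed
  moreover have "b j \<in> F i" if "j < n" for j
    using bB[OF that] span_base B(4) by blast
  ultimately have "coordinates i n b X"
    unfolding coordinates_def X_def using B(3,4)
    by (auto simp: representation_add representation_scale)
  then show ?thesis by blast
qed

lemma coord_in: "\<lbrakk>coordinates i n b X; j < n\<rbrakk> \<Longrightarrow> b j \<in> F i"
  and coord_add: "\<lbrakk>coordinates i n b X; j < n; x \<in> F i; y \<in> F i\<rbrakk> \<Longrightarrow> X j (x + y) = X j x + X j y"
  and coord_scale: "\<lbrakk>coordinates i n b X; j < n; x \<in> F i\<rbrakk> \<Longrightarrow> X j (r *s x) = r * X j x"
  and coord_expand: "\<lbrakk>coordinates i n b X; x \<in> F i\<rbrakk> \<Longrightarrow> (\<Sum>j<n. X j x *s b j) = x"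
  unfolding coordinates_def by simp_all

lemma linI:
  assumes "\<And>x. x \<in> F i \<Longrightarrow> f x \<in> F j"
    and "\<And>x y. \<lbrakk>x \<in> F i; y \<in> F i\<rbrakk> \<Longrightarrow> f (x + y) = f x + f y"
    and "\<And>r x. x \<in> F i \<Longrightarrow> f (r *s x) = r *s f x"
  shows "lin i j f"
  using assms unfolding linear_between_def by auto

lemma lin_in: "\<lbrakk>lin i j f; x \<in> F i\<rbrakk> \<Longrightarrow> f x \<in> F j"
  and lin_add: "\<lbrakk>lin i j f; x \<in> F i; y \<in> F i\<rbrakk> \<Longrightarrow> f (x + y) = f x + f y"
  and lin_scale: "\<lbrakk>lin i j f; x \<in> F i\<rbrakk> \<Longrightarrow> f (r *s x) = r *s f x"
  unfolding linear_between_def by auto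

lemma lin_zero: "lin i j f \<Longrightarrow> f 0 = 0"
  using lin_scale[of i j f 0 0] by simp

lemma lin_neg: "\<lbrakk>lin i j f; x \<in> F i\<rbrakk> \<Longrightarrow> f (- x) = - f x"
  using lin_scale[of i j f x "- 1"] by simp

lemma lin_diff: "\<lbrakk>lin i j f; x \<in> F i; y \<in> F i\<rbrakk> \<Longrightarrow> f (x - y) = f x - f y"
  using lin_add[of i j f x "- y"] lin_neg[of i j f y] F_uminus[of y i] by simp

lemma lin_sum:
  assumes "lin i j f" "\<And>s. s \<in> S \<Longrightarrow> g s \<in> F i"
  shows "f (sum g S) = (\<Sum>s\<in>S. f (g s))"
  using assms(2)
proof (induction S rule: infinite_finite_induct)
  case (insert s S)
  then show ?case
    using lin_add[OF assms(1), of "g s" "sum g S"] F_sum[of S g i] by auto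
qed (use lin_zero[OF assms(1)] in auto)

lemma lin_combination:
  assumes "lin i j f" "\<And>s. s \<in> S \<Longrightarrow> g s \<in> F i"
  shows "f (\<Sum>s\<in>S. c s *s g s) = (\<Sum>s\<in>S. c s *s f (g s))"
proof -
  have "f (\<Sum>s\<in>S. c s *s g s) = (\<Sum>s\<in>S. f (c s *s g s))"
    using assms(2) by (intro lin_sum[OF assms(1)] F_scale)
  also have "\<dots> = (\<Sum>s\<in>S. c s *s f (g s))"
    using assms by (intro sum.cong refl lin_scale)
  finally show ?thesis .
qed

lemma lin_combination2:
  assumes "lin i j f" "\<And>s t. \<lbrakk>s \<in> S; t \<in> T\<rbrakk> \<Longrightarrow> g s t \<in> F i"
  shows "f (\<Sum>s\<in>S. \<Sum>t\<in>T. c s t *s g s t) = (\<Sum>s\<in>S. \<Sum>t\<in>T. c s t *s f (g s t))"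
proof -
  have "f (\<Sum>s\<in>S. \<Sum>t\<in>T. c s t *s g s t) = (\<Sum>s\<in>S. f (\<Sum>t\<in>T. c s t *s g s t))"
    using assms(2) by (intro lin_sum[OF assms(1)] F_sum F_scale)
  also have "\<dots> = (\<Sum>s\<in>S. \<Sum>t\<in>T. c s t *s f (g s t))"
    using assms by (intro sum.cong refl lin_combination)
  finally show ?thesis .
qed

lemma lin_combination3:
  assumes "lin i j f" "\<And>s t u. \<lbrakk>s \<in> S; t \<in> T; u \<in> U\<rbrakk> \<Longrightarrow> g s t u \<in> F i"
  shows "f (\<Sum>s\<in>S. \<Sum>t\<in>T. \<Sum>u\<in>U. c s t u *s g s t u) =
    (\<Sum>s\<in>S. \<Sum>t\<in>T. \<Sum>u\<in>U. c s t u *s f (g s t u))"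
proof -
  have "f (\<Sum>s\<in>S. \<Sum>t\<in>T. \<Sum>u\<in>U. c s t u *s g s t u) =
      (\<Sum>s\<in>S. f (\<Sum>t\<in>T. \<Sum>u\<in>U. c s t u *s g s t u))"
    using assms(2) by (intro lin_sum[OF assms(1)] F_sum F_scale)
  also have "\<dots> = (\<Sum>s\<in>S. \<Sum>t\<in>T. \<Sum>u\<in>U. c s t u *s f (g s t u))"
    using assms by (intro sum.cong refl lin_combination2)
  finally show ?thesis .
qed

lemmas lin_rules = lin_in lin_add lin_scale lin_zero lin_neg lin_diff

lemma lin_id: "lin i i (\<lambda>x. x)"
  by (rule linI) auto

lemma lin_compose: "\<lbrakk>lin i j f; lin j k g\<rbrakk> \<Longrightarrow> lin i k (\<lambda>x. g (f x))"
  by (rule linI) (auto simp: lin_rules[of i j f] lin_rules[of j k g])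

lemma lin_plus: "\<lbrakk>lin i j f; lin i j g\<rbrakk> \<Longrightarrow> lin i j (\<lambda>x. f x + g x)"
  by (rule linI) (auto simp: lin_rules[of i j f] lin_rules[of i j g] F_closed algebra_simps
      scale_right_distrib)

lemma lin_minus: "\<lbrakk>lin i j f; lin i j g\<rbrakk> \<Longrightarrow> lin i j (\<lambda>x. f x - g x)"
  by (rule linI) (auto simp: lin_rules[of i j f] lin_rules[of i j g] F_closed algebra_simps
      scale_right_diff_distrib)

lemma lin_uminus: "lin i j f \<Longrightarrow> lin i j (\<lambda>x. - f x)"
  by (rule linI) (auto simp: lin_rules[of i j f] F_closed)

lemma lin_scale_map: "lin i j f \<Longrightarrow> lin i j (\<lambda>x. r *s f x)"
  by (rule linI) (auto simp: lin_rules[of i j f] F_closed scale_right_distrib mult.commute)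

lemma lin_zero_map: "lin i j (\<lambda>x. 0)"
  by (rule linI) auto

lemma lin_sum_map:
  assumes "\<And>s. s \<in> S \<Longrightarrow> lin i j (f s)"
  shows "lin i j (\<lambda>x. \<Sum>s\<in>S. f s x)"
  using assms
  by (induction S rule: infinite_finite_induct) (auto intro: lin_plus lin_zero_map)

lemma lin_d: "lin i (i - 1) (d i)"
  by (rule d_linear)

lemma bilI:
  assumes "\<And>y. y \<in> F j \<Longrightarrow> lin i k (\<lambda>x. f x y)" "\<And>x. x \<in> F i \<Longrightarrow> lin j k (f x)"
  shows "bil i j k f"
  using assms unfolding bil_def by auto

lemma bil_left: "\<lbrakk>bil i j k f; y \<in> F j\<rbrakk> \<Longrightarrow> lin i k (\<lambda>x. f x y)"
  and bil_right: "\<lbrakk>bil i j k f; x \<in> F i\<rbrakk> \<Longrightarrow> lin j k (f x)"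
  unfolding bil_def by auto

lemma bil_in: "\<lbrakk>bil i j k f; x \<in> F i; y \<in> F j\<rbrakk> \<Longrightarrow> f x y \<in> F k"
  using bil_right lin_in by blast

lemmas bil_rules = bil_in
  lin_add[OF bil_left] lin_scale[OF bil_left] lin_zero[OF bil_left] lin_neg[OF bil_left]
  lin_diff[OF bil_left]
  lin_add[OF bil_right] lin_scale[OF bil_right] lin_zero[OF bil_right] lin_neg[OF bil_right]
  lin_diff[OF bil_right]

lemma bil_flip: "bil i j k f \<Longrightarrow> bil j i k (\<lambda>x y. f y x)"
  unfolding bil_def by auto

lemma bil_plus: "\<lbrakk>bil i j k f; bil i j k g\<rbrakk> \<Longrightarrow> bil i j k (\<lambda>x y. f x y + g x y)"
  unfolding bil_def using lin_plus by auto

lemma bil_minus: "\<lbrakk>bil i j k f; bil i j k g\<rbrakk> \<Longrightarrow> bil i j k (\<lambda>x y. f x y - g x y)"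
  unfolding bil_def using lin_minus by auto

lemma bil_uminus: "bil i j k f \<Longrightarrow> bil i j k (\<lambda>x y. - f x y)"
  unfolding bil_def using lin_uminus by auto

lemma bil_zero: "bil i j k (\<lambda>x y. 0)"
  unfolding bil_def using lin_zero_map by auto

lemma bil_compose: "\<lbrakk>bil i j k f; lin k l g\<rbrakk> \<Longrightarrow> bil i j l (\<lambda>x y. g (f x y))"
  unfolding bil_def using lin_compose by blast

lemma bil_compose_left: "\<lbrakk>bil i j k f; lin l i g\<rbrakk> \<Longrightarrow> bil l j k (\<lambda>x y. f (g x) y)"
  by (rule bilI) (auto intro: bil_right lin_in lin_compose[where f = g] bil_left)

lemma bil_compose_right: "\<lbrakk>bil i j k f; lin l j g\<rbrakk> \<Longrightarrow> bil i l k (\<lambda>x y. f x (g y))"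
  by (rule bilI) (auto intro: bil_left lin_in lin_compose bil_right)

lemma bil_expand:
  assumes G: "bil i j k G" and X: "coordinates i n b X" and Y: "coordinates j m c Y"
    and x: "x \<in> F i" and y: "y \<in> F j"
  shows "G x y = (\<Sum>p<n. \<Sum>q<m. (X p x * Y q y) *s G (b p) (c q))"
proof -
  have "G x y = G (\<Sum>p<n. X p x *s b p) y"
    using coord_expand[OF X x] by simp
  also have "\<dots> = (\<Sum>p<n. X p x *s G (b p) y)"
    using lin_sum[OF bil_left[OF G y], of "{..<n}" "\<lambda>p. X p x *s b p"] coord_in[OF X]
      lin_scale[OF bil_left[OF G y]] by (simp add: F_scale)
  also have "\<dots> = (\<Sum>p<n. X p x *s G (b p) (\<Sum>q<m. Y q y *s c q))"
    using coord_expand[OF Y y] by simp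
  also have "\<dots> = (\<Sum>p<n. \<Sum>q<m. (X p x * Y q y) *s G (b p) (c q))"
    using lin_sum[OF bil_right[OF G], of _ "{..<m}" "\<lambda>q. Y q y *s c q"] coord_in[OF X] coord_in[OF Y]
      lin_scale[OF bil_right[OF G]]
    by (simp add: F_scale scale_sum_right)
  finally show ?thesis .
qed

lemma lin_coord_combination:
  assumes X: "coordinates i n b X" and s: "\<And>p. p < n \<Longrightarrow> s p \<in> F k"
  shows "lin i k (\<lambda>x. \<Sum>p<n. X p x *s s p)"
  by (rule linI)
    (auto intro!: F_sum F_scale s sum.cong
      simp: coord_add[OF X] coord_scale[OF X] scale_left_distrib scale_sum_right simp flip: sum.distrib)

lemma bil_coord_combination:
  assumes X: "coordinates i n b X" and Y: "coordinates j m c Y"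
    and s: "\<And>p q. \<lbrakk>p < n; q < m\<rbrakk> \<Longrightarrow> s p q \<in> F k"
  shows "bil i j k (\<lambda>x y. \<Sum>p<n. \<Sum>q<m. (X p x * Y q y) *s s p q)"
proof (rule bilI)
  fix y
  have "lin i k (\<lambda>x. \<Sum>p<n. X p x *s (\<Sum>q<m. Y q y *s s p q))"
    by (intro lin_coord_combination[OF X] F_sum F_scale s) auto
  then show "lin i k (\<lambda>x. \<Sum>p<n. \<Sum>q<m. (X p x * Y q y) *s s p q)"
    by (simp add: scale_sum_right)
next
  fix x
  have "lin j k (\<lambda>y. \<Sum>q<m. Y q y *s (\<Sum>p<n. X p x *s s p q))"
    by (intro lin_coord_combination[OF Y] F_sum F_scale s) auto
  moreover have "(\<Sum>q<m. Y q y *s (\<Sum>p<n. X p x *s s p q)) =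
      (\<Sum>p<n. \<Sum>q<m. (X p x * Y q y) *s s p q)" for y
    by (subst sum.swap) (simp add: scale_sum_right mult.commute)
  ultimately show "lin j k (\<lambda>y. \<Sum>p<n. \<Sum>q<m. (X p x * Y q y) *s s p q)"
    by simp
qed

section \<open>Lifting multilinear maps along the differential\<close>

text \<open>
As \<open>F i\<close> and \<open>F j\<close> are free, preimages of the finitely many \<open>G (b p) (c q)\<close> can be chosen freely
and extended bilinearly.
\<close>

lemma bilinear_lift:
  assumes G: "bil i j (l - 1) G"
    and im: "\<And>x y. \<lbrakk>x \<in> F i; y \<in> F j\<rbrakk> \<Longrightarrow> G x y \<in> d l ` F l"
  shows "\<exists>H. bil i j l H \<and> (\<forall>x\<in>F i. \<forall>y\<in>F j. d l (H x y) = G x y)"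
proof -
  obtain n b X where X: "coordinates i n b X"
    using coordinates_exist by blast
  obtain m c Y where Y: "coordinates j m c Y"
    using coordinates_exist by blast
  have "\<forall>p q. \<exists>s. p < n \<longrightarrow> q < m \<longrightarrow> s \<in> F l \<and> d l s = G (b p) (c q)"
    using im coord_in[OF X] coord_in[OF Y] by (metis (no_types, lifting) imageE)
  then obtain s where
    s: "\<And>p q. \<lbrakk>p < n; q < m\<rbrakk> \<Longrightarrow> s p q \<in> F l \<and> d l (s p q) = G (b p) (c q)"
    by metis
  define H where "H = (\<lambda>x y. \<Sum>p<n. \<Sum>q<m. (X p x * Y q y) *s s p q)"
  have "bil i j l H"
    unfolding H_def using s by (intro bil_coord_combination[OF X Y]) blast
  moreover have "d l (H x y) = G x y" if "x \<in> F i" "y \<in> F j" for x y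
  proof -
    have "d l (H x y) = (\<Sum>p<n. \<Sum>q<m. (X p x * Y q y) *s d l (s p q))"
      unfolding H_def using s by (intro lin_combination2[OF lin_d]) simp
    also have "\<dots> = G x y"
      using s by (simp add: bil_expand[OF G X Y that])
    finally show ?thesis .
  qed
  ultimately show ?thesis by blast
qed

text \<open>
An arbitrary bilinear lift need not be alternating, and it cannot be antisymmetrised when \<open>2\<close> is
not invertible. Instead preimages are chosen only for \<open>p < q\<close>, and the others are given by the
signs.
\<close>

lemma alternating_bilinear_lift:
  assumes G: "bil i i (l - 1) G"
    and alt: "\<And>x. x \<in> F i \<Longrightarrow> G x x = 0"
    and im: "\<And>x y. \<lbrakk>x \<in> F i; y \<in> F i\<rbrakk> \<Longrightarrow> G x y \<in> d l ` F l"
  shows "\<exists>H. bil i i l H \<and> (\<forall>x\<in>F i. H x x = 0) \<and> (\<forall>x\<in>F i. \<forall>y\<in>F i. d l (H x y) = G x y)"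
proof -
  obtain n b X where X: "coordinates i n b X"
    using coordinates_exist by blast
  note b = coord_in[OF X]
  have "\<forall>p q. \<exists>s. p < n \<longrightarrow> q < n \<longrightarrow> s \<in> F l \<and> d l s = G (b p) (b q)"
    using im b by (metis (no_types, lifting) imageE)
  then obtain s0 where
    s0: "\<And>p q. \<lbrakk>p < n; q < n\<rbrakk> \<Longrightarrow> s0 p q \<in> F l \<and> d l (s0 p q) = G (b p) (b q)"
    by metis
  have G_swap: "G y x = - G x y" if "x \<in> F i" "y \<in> F i" for x y
    using alt[of "x + y"] that alt[of x] alt[of y]
    by (simp add: bil_rules[OF G] F_closed eq_neg_iff_add_eq_0 add.commute)
  define s where "s p q = (if p < q then s0 p q else if q < p then - s0 q p else 0)" for p q
  have s: "s p q \<in> F l \<and> d l (s p q) = G (b p) (b q)" if "p < n" "q < n" for p q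
    using s0 that b G_swap[of "b q" "b p"] alt
    by (cases p q rule: linorder_cases)
      (auto simp: s_def F_closed lin_neg[OF lin_d] lin_zero[OF lin_d])
  have s_swap: "s q p = - s p q" "s p p = 0" for p q
    by (auto simp: s_def)
  define H where "H = (\<lambda>x y. \<Sum>p<n. \<Sum>q<n. (X p x * X q y) *s s p q)"
  have "bil i i l H"
    unfolding H_def using s by (intro bil_coord_combination[OF X X]) blast
  moreover have "d l (H x y) = G x y" if "x \<in> F i" "y \<in> F i" for x y
  proof -
    have "d l (H x y) = (\<Sum>p<n. \<Sum>q<n. (X p x * X q y) *s d l (s p q))"
      unfolding H_def using s by (intro lin_combination2[OF lin_d]) simp
    also have "\<dots> = G x y"
      using s by (simp add: bil_expand[OF G X X that])
    finally show ?thesis .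
  qed
  moreover have "H x x = 0" for x
    unfolding H_def
  proof (rule alternating_double_sum_eq_0)
    show "(X p x * X p x) *s s p p = 0" for p
      by (simp add: s_swap(2))
    show "(X q x * X p x) *s s q p = - ((X p x * X q x) *s s p q)" for p q
      by (subst s_swap(1)) (simp add: mult.commute)
  qed
  ultimately show ?thesis by blast
qed

definition tril :: "int \<Rightarrow> int \<Rightarrow> ('m \<Rightarrow> 'm \<Rightarrow> 'm \<Rightarrow> 'm) \<Rightarrow> bool" where
  "tril i k f \<longleftrightarrow> (\<forall>x\<in>F i. bil i i k (f x)) \<and> (\<forall>y\<in>F i. \<forall>z\<in>F i. lin i k (\<lambda>x. f x y z))"

lemma tril_expand:
  assumes G: "tril i k G" and X: "coordinates i n b X"
    and x: "x \<in> F i" and y: "y \<in> F i" and z: "z \<in> F i"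
  shows "G x y z = (\<Sum>p<n. \<Sum>q<n. \<Sum>r<n. (X p x * X q y * X r z) *s G (b p) (b q) (b r))"
proof -
  have L: "lin i k (\<lambda>x. G x y z)" and B: "\<And>x. x \<in> F i \<Longrightarrow> bil i i k (G x)"
    using G y z unfolding tril_def by auto
  have "G x y z = G (\<Sum>p<n. X p x *s b p) y z"
    using coord_expand[OF X x] by simp
  also have "\<dots> = (\<Sum>p<n. X p x *s G (b p) y z)"
    using lin_sum[OF L, of "{..<n}" "\<lambda>p. X p x *s b p"] coord_in[OF X]
      lin_scale[OF L] by (simp add: F_scale)
  also have "\<dots> = (\<Sum>p<n. \<Sum>q<n. \<Sum>r<n. (X p x * X q y * X r z) *s G (b p) (b q) (b r))"
    using bil_expand[OF B X X y z] coord_in[OF X]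
    by (simp add: scale_sum_right mult.assoc)
  finally show ?thesis .
qed

text \<open>
The same idea for three arguments: preimages are chosen for \<open>p < q < r\<close> only.
\<close>

lemma alternating_trilinear_lift:
  assumes G: "tril i (l - 1) G"
    and alt: "\<And>x y. \<lbrakk>x \<in> F i; y \<in> F i\<rbrakk> \<Longrightarrow> G x x y = 0 \<and> G x y y = 0"
    and im: "\<And>x y z. \<lbrakk>x \<in> F i; y \<in> F i; z \<in> F i\<rbrakk> \<Longrightarrow> G x y z \<in> d l ` F l"
  shows "\<exists>H. tril i l H \<and> (\<forall>x\<in>F i. \<forall>y\<in>F i. H x x y = 0 \<and> H x y y = 0) \<and>
    (\<forall>x\<in>F i. \<forall>y\<in>F i. \<forall>z\<in>F i. d l (H x y z) = G x y z)"
proof -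
  obtain n b X where X: "coordinates i n b X"
    using coordinates_exist by blast
  note b = coord_in[OF X]
  have "\<forall>p q r. \<exists>s. p < n \<longrightarrow> q < n \<longrightarrow> r < n \<longrightarrow> s \<in> F l \<and> d l s = G (b p) (b q) (b r)"
    using im b by (metis (no_types, lifting) imageE)
  then obtain s0 where
    s0: "\<And>p q r. \<lbrakk>p < n; q < n; r < n\<rbrakk> \<Longrightarrow> s0 p q r \<in> F l \<and> d l (s0 p q r) = G (b p) (b q) (b r)"
    by metis
  have B: "bil i i (l - 1) (G x)" if "x \<in> F i" for x
    using G that unfolding tril_def by auto
  have L: "lin i (l - 1) (\<lambda>x. G x y z)" if "y \<in> F i" "z \<in> F i" for y z
    using G that unfolding tril_def by auto
  have swap23: "G x z y = - G x y z" if "x \<in> F i" "y \<in> F i" "z \<in> F i" for x y z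
    using alt[of x "y + z"] that alt[of x y] alt[of x z]
    by (simp add: bil_rules[OF B] F_closed eq_neg_iff_add_eq_0 add.commute)
  have swap12: "G y x z = - G x y z" if "x \<in> F i" "y \<in> F i" "z \<in> F i" for x y z
    using alt[of "x + y" z] that alt[of x z] alt[of y z]
    by (simp add: bil_rules[OF B] lin_add[OF L] F_closed eq_neg_iff_add_eq_0 add.commute)
  define s where "s p q r =
    (if p < q \<and> q < r then s0 p q r else if p < r \<and> r < q then - s0 p r q
     else if q < p \<and> p < r then - s0 q p r else if q < r \<and> r < p then s0 q r p
     else if r < p \<and> p < q then s0 r p q else if r < q \<and> q < p then - s0 r q p else 0)" for p q r
  have s: "s p q r \<in> F l \<and> d l (s p q r) = G (b p) (b q) (b r)" if pqr: "p < n" "q < n" "r < n" for p q r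
  proof -
    note bp = b[OF pqr(1)] and bq = b[OF pqr(2)] and br = b[OF pqr(3)]
    have mem: "s p q r \<in> F l"
      using s0 pqr by (auto simp: s_def F_closed)
    have eqs: "G (b p) (b r) (b q) = - G (b p) (b q) (b r)"
      "G (b q) (b p) (b r) = - G (b p) (b q) (b r)"
      "G (b q) (b r) (b p) = G (b p) (b q) (b r)"
      "G (b r) (b p) (b q) = G (b p) (b q) (b r)"
      "G (b r) (b q) (b p) = - G (b p) (b q) (b r)"
      using swap12 swap23 bp bq br by (metis minus_minus)+
    have zero: "G (b p) (b q) (b r) = 0" if "p = q \<or> q = r \<or> p = r"
      using that alt bp bq br eqs by (metis minus_zero)
    have "d l (s p q r) = G (b p) (b q) (b r)"
    proof (cases "p = q \<or> q = r \<or> p = r")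
      case True
      then have "s p q r = 0" by (auto simp: s_def)
      then show ?thesis using zero[OF True] by (simp add: lin_zero[OF lin_d])
    next
      case False
      then consider "p < q \<and> q < r" | "p < r \<and> r < q" | "q < p \<and> p < r" | "q < r \<and> r < p"
        | "r < p \<and> p < q" | "r < q \<and> q < p" by linarith
      then show ?thesis
        using s0 pqr eqs by cases (auto simp: s_def lin_neg[OF lin_d])
    qed
    with mem show ?thesis by blast
  qed
  have s_swap: "s q p r = - s p q r" "s p r q = - s p q r" "s p p q = 0" "s p q q = 0" for p q r
    by (auto simp: s_def)
  define H where "H = (\<lambda>x y z. \<Sum>p<n. \<Sum>q<n. \<Sum>r<n. (X p x * X q y * X r z) *s s p q r)"
  have H1: "H x y z = (\<Sum>p<n. X p x *s (\<Sum>q<n. \<Sum>r<n. (X q y * X r z) *s s p q r))" for x y z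
    unfolding H_def by (simp add: scale_sum_right mult.assoc)
  have H2: "H x y z = (\<Sum>q<n. \<Sum>r<n. (X q y * X r z) *s (\<Sum>p<n. X p x *s s p q r))" for x y z
  proof -
    have "H x y z = (\<Sum>q<n. \<Sum>p<n. \<Sum>r<n. (X p x * X q y * X r z) *s s p q r)"
      unfolding H_def by (rule sum.swap)
    also have "\<dots> = (\<Sum>q<n. \<Sum>r<n. \<Sum>p<n. (X p x * X q y * X r z) *s s p q r)"
      by (intro sum.cong refl sum.swap)
    finally show ?thesis
      by (simp add: scale_sum_right mult_ac)
  qed
  have "tril i l H"
    unfolding tril_def
  proof (intro conjI ballI)
    fix x
    have "bil i i l (\<lambda>y z. \<Sum>q<n. \<Sum>r<n. (X q y * X r z) *s (\<Sum>p<n. X p x *s s p q r))"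
      using s by (intro bil_coord_combination[OF X X] F_sum F_scale) auto
    moreover have "H x = (\<lambda>y z. \<Sum>q<n. \<Sum>r<n. (X q y * X r z) *s (\<Sum>p<n. X p x *s s p q r))"
      by (intro ext H2)
    ultimately show "bil i i l (H x)"
      by simp
  next
    fix y z
    have "lin i l (\<lambda>x. \<Sum>p<n. X p x *s (\<Sum>q<n. \<Sum>r<n. (X q y * X r z) *s s p q r))"
      using s by (intro lin_coord_combination[OF X] F_sum F_scale) auto
    then show "lin i l (\<lambda>x. H x y z)"
      by (simp add: H1)
  qed
  moreover have "d l (H x y z) = G x y z" if "x \<in> F i" "y \<in> F i" "z \<in> F i" for x y z
  proof -
    have "d l (H x y z) = (\<Sum>p<n. \<Sum>q<n. \<Sum>r<n. (X p x * X q y * X r z) *s d l (s p q r))"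
      unfolding H_def using s by (intro lin_combination3[OF lin_d]) simp
    also have "\<dots> = G x y z"
      using s by (simp add: tril_expand[OF G X that])
    finally show ?thesis .
  qed
  moreover have "H x x y = 0" for x y
    unfolding H_def
  proof (rule alternating_double_sum_eq_0)
    show "(\<Sum>r<n. (X p x * X p x * X r y) *s s p p r) = 0" for p
      by (simp add: s_swap(3))
    show "(\<Sum>r<n. (X q x * X p x * X r y) *s s q p r) =
        - (\<Sum>r<n. (X p x * X q x * X r y) *s s p q r)" for p q
      by (subst s_swap(1)) (simp add: mult.commute sum_negf)
  qed
  moreover have "H x y y = 0" for x y
    unfolding H1
  proof (intro sum.neutral ballI)
    fix p
    have "(\<Sum>q<n. \<Sum>r<n. (X q y * X r y) *s s p q r) = 0"
    proof (rule alternating_double_sum_eq_0)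
      show "(X q y * X q y) *s s p q q = 0" for q
        by (simp add: s_swap(4))
      show "(X r y * X q y) *s s p r q = - ((X q y * X r y) *s s p q r)" for q r
        by (subst s_swap(2)) (simp add: mult.commute)
    qed
    then show "X p x *s (\<Sum>q<n. \<Sum>r<n. (X q y * X r y) *s s p q r) = 0"
      by simp
  qed
  ultimately show ?thesis by blast
qed

section \<open>The augmentation and the exactness of a resolution of length four\<close>

text \<open>
The identification of \<open>F 0\<close> with \<open>P\<close>; through it the differential of an element of degree \<open>1\<close>
becomes the scalar \<open>aug x\<close>.
\<close>

definition coeff :: "'m \<Rightarrow> 'p" where
  "coeff x = (THE r. x = r *s e)"

definition aug :: "'m \<Rightarrow> 'p" where
  "aug x = coeff (d 1 x)"

lemma scale_e_eq_iff: "r *s e = s *s e \<longleftrightarrow> r = s"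
  using F_0 unfolding module_iso_def bij_betw_def inj_on_def by auto

lemma e_in [simp]: "e \<in> F 0"
  using F_0 unfolding module_iso_def bij_betw_def by (metis rangeI scale_one)

lemma coeff_scale_e [simp]: "coeff (r *s e) = r"
  unfolding coeff_def by (auto simp: scale_e_eq_iff)

lemma coeff_e [simp]: "coeff e = 1"
  using coeff_scale_e[of 1] by simp

lemma scale_coeff:
  assumes "x \<in> F 0"
  shows "coeff x *s e = x"
proof -
  obtain r where "x = r *s e"
    using F_0 assms unfolding module_iso_def bij_betw_def by auto
  then show ?thesis by simp
qed

lemma coeff_add: "\<lbrakk>x \<in> F 0; y \<in> F 0\<rbrakk> \<Longrightarrow> coeff (x + y) = coeff x + coeff y"
  by (metis coeff_scale_e scale_coeff scale_left_distrib)

lemma coeff_scale: "x \<in> F 0 \<Longrightarrow> coeff (r *s x) = r * coeff x"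
  by (metis coeff_scale_e scale_coeff scale_scale)

lemma d1: "lin 1 0 (d 1)"
  using lin_d[of 1] by simp

lemma d2: "lin 2 1 (d 2)"
  using lin_d[of 2] by simp

lemma d3: "lin 3 2 (d 3)"
  using lin_d[of 3] by simp

lemma d4: "lin 4 3 (d 4)"
  using lin_d[of 4] by simp

lemmas d_rules = lin_rules[OF d1] lin_rules[OF d2] lin_rules[OF d3] lin_rules[OF d4]

lemma d1_aug: "x \<in> F 1 \<Longrightarrow> d 1 x = aug x *s e"
  unfolding aug_def using scale_coeff d_rules by simp

lemma d_d_2: "v \<in> F 2 \<Longrightarrow> d 1 (d 2 v) = 0"
  and d_d_3: "\<xi> \<in> F 3 \<Longrightarrow> d 2 (d 3 \<xi>) = 0"
  and d_d_4: "t \<in> F 4 \<Longrightarrow> d 3 (d 4 t) = 0"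
  using d_d[of v 2] d_d[of \<xi> 3] d_d[of t 4] by auto

lemma coeff_zero [simp]: "coeff 0 = 0"
  using coeff_scale_e[of 0] by simp

lemma aug_zero [simp]: "aug 0 = 0"
  unfolding aug_def by (simp add: d_rules)

lemma aug_add: "\<lbrakk>x \<in> F 1; y \<in> F 1\<rbrakk> \<Longrightarrow> aug (x + y) = aug x + aug y"
  unfolding aug_def by (simp add: d_rules coeff_add)

lemma aug_scale: "x \<in> F 1 \<Longrightarrow> aug (r *s x) = r * aug x"
  unfolding aug_def by (simp add: d_rules coeff_scale)

lemma aug_d2: "v \<in> F 2 \<Longrightarrow> aug (d 2 v) = 0"
  unfolding aug_def by (simp add: d_d_2)

lemma aug_neg: "x \<in> F 1 \<Longrightarrow> aug (- x) = - aug x"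
  using aug_scale[of x "- 1"] by simp

lemma aug_diff: "\<lbrakk>x \<in> F 1; y \<in> F 1\<rbrakk> \<Longrightarrow> aug (x - y) = aug x - aug y"
  using aug_add[of x "- y"] aug_neg F_uminus by simp

lemmas aug_rules = aug_zero aug_add aug_scale aug_d2 aug_neg aug_diff

lemma bil_aug_left: "bil 1 j j (\<lambda>x y. aug x *s y)"
  by (intro bilI linI)
    (auto simp: F_closed aug_rules scale_left_distrib scale_right_distrib mult.commute)

lemma bil_aug_right: "bil i 1 i (\<lambda>x y. aug y *s x)"
  using bil_flip[OF bil_aug_left] by simp

text \<open>
Perfection of a pairing is handled below as unique solvability of \<open>p x y = f y\<close> for every linear
\<open>f\<close>; this turns it into an isomorphism onto the module of homomorphisms.
\<close>

lemma perfect_pairing_iso: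
  assumes p: "bil i j k p"
    and perfect: "\<And>f. lin j k f \<Longrightarrow> \<exists>!x. x \<in> F i \<and> (\<forall>y\<in>F j. p x y = f y)"
  shows "module_iso scale (F i) (Hom_scale scale) (Hom scale (F j) (F k))
    (\<lambda>x. extend0 (F j) (p x))"
  unfolding module_iso_def
proof
  show "linear_between scale (F i) (Hom_scale scale) (Hom scale (F j) (F k))
      (\<lambda>x. extend0 (F j) (p x))"
    unfolding linear_between_def[of _ "F i"]
  proof (intro conjI ballI allI image_subsetI)
    fix x assume x: "x \<in> F i"
    have "lin j k (extend0 (F j) (p x))"
      by (rule linI) (simp_all add: extend0_def F_closed bil_rules[OF p] x)
    then show "extend0 (F j) (p x) \<in> Hom scale (F j) (F k)"
      unfolding Hom_def by (simp add: extend0_def)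
  qed (auto simp: extend0_def fun_eq_iff Hom_scale_def bil_rules[OF p])
  show "bij_betw (\<lambda>x. extend0 (F j) (p x)) (F i) (Hom scale (F j) (F k))"
    unfolding bij_betw_def
  proof
    show "inj_on (\<lambda>x. extend0 (F j) (p x)) (F i)"
    proof (rule inj_onI)
      fix x x' assume xx: "x \<in> F i" "x' \<in> F i" and "extend0 (F j) (p x) = extend0 (F j) (p x')"
      then have "\<forall>y\<in>F j. p x y = p x' y"
        unfolding extend0_def fun_eq_iff by metis
      then show "x = x'"
        using perfect[OF bil_right[OF p xx(2)]] xx by blast
    qed
    show "(\<lambda>x. extend0 (F j) (p x)) ` F i = Hom scale (F j) (F k)"
    proof (intro equalityI image_subsetI subsetI)
      fix x assume x: "x \<in> F i"
      have "lin j k (extend0 (F j) (p x))"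
        by (rule linI) (simp_all add: extend0_def F_closed bil_rules[OF p] x)
      then show "extend0 (F j) (p x) \<in> Hom scale (F j) (F k)"
        unfolding Hom_def by (simp add: extend0_def)
    next
      fix f assume f: "f \<in> Hom scale (F j) (F k)"
      then obtain x where "x \<in> F i" "\<forall>y\<in>F j. p x y = f y"
        using perfect[of f] unfolding Hom_def by blast
      moreover from this f have "f = extend0 (F j) (p x)"
        unfolding Hom_def extend0_def by auto
      ultimately show "f \<in> (\<lambda>x. extend0 (F j) (p x)) ` F i"
        by blast
    qed
  qed
qed

lemma bil_coeff_left: "bil 0 j j (\<lambda>x y. coeff x *s y)"
  by (intro bilI linI)
    (simp_all add: F_closed coeff_add coeff_scale scale_left_distrib scale_right_distrib
      mult.commute)

lemma bil_coeff_right: "bil i 0 i (\<lambda>x y. coeff y *s x)"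
  using bil_flip[OF bil_coeff_left] by simp

end

locale length_four_resolution = free_resolution scale F d e
  for scale :: "'p::comm_ring_1 \<Rightarrow> 'm::ab_group_add \<Rightarrow> 'm" (infixr \<open>*s\<close> 75)
    and F :: "int \<Rightarrow> 'm set" and d :: "int \<Rightarrow> 'm \<Rightarrow> 'm" and e :: 'm +
  assumes F_above: "4 < i \<Longrightarrow> F i = {0}"
begin

lemma exact1:
  assumes "x \<in> F 1" "aug x = 0"
  shows "x \<in> d 2 ` F 2"
proof -
  have "x \<in> {x \<in> F 1. d 1 x = 0}"
    using assms by (simp add: d1_aug)
  then show ?thesis
    using exact[of 1] by simp
qed

lemma exact2:
  assumes "v \<in> F 2" "d 2 v = 0"
  shows "v \<in> d 3 ` F 3"
proof -
  have "v \<in> {v \<in> F 2. d 2 v = 0}"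
    using assms by simp
  then show ?thesis
    using exact[of 2] by simp
qed

lemma exact3:
  assumes "\<xi> \<in> F 3" "d 3 \<xi> = 0"
  shows "\<xi> \<in> d 4 ` F 4"
proof -
  have "\<xi> \<in> {\<xi> \<in> F 3. d 3 \<xi> = 0}"
    using assms by simp
  then show ?thesis
    using exact[of 3] by simp
qed

lemma d4_eq_0: "\<lbrakk>t \<in> F 4; d 4 t = 0\<rbrakk> \<Longrightarrow> t = 0"
  using exact[of 4] F_above[of 5] lin_zero[OF lin_d, of 5] by auto

lemma d4_inj: "\<lbrakk>s \<in> F 4; t \<in> F 4; d 4 s = d 4 t\<rbrakk> \<Longrightarrow> s = t"
  using d4_eq_0[of "s - t"] by (simp add: F_closed d_rules)

definition inv4 :: "'m \<Rightarrow> 'm" where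
  "inv4 \<xi> = (THE t. t \<in> F 4 \<and> d 4 t = \<xi>)"

lemma inv4:
  assumes "\<xi> \<in> F 3" "d 3 \<xi> = 0"
  shows "inv4 \<xi> \<in> F 4" "d 4 (inv4 \<xi>) = \<xi>"
proof -
  have "\<exists>!t. t \<in> F 4 \<and> d 4 t = \<xi>"
    using exact3[OF assms] d4_inj by auto
  then show "inv4 \<xi> \<in> F 4" "d 4 (inv4 \<xi>) = \<xi>"
    unfolding inv4_def by (metis (mono_tags, lifting) theI')+
qed

lemma inv4_eqI: "\<lbrakk>t \<in> F 4; d 4 t = \<xi>\<rbrakk> \<Longrightarrow> inv4 \<xi> = t"
  unfolding inv4_def using d4_inj by (intro the_equality) auto

lemma lin_inv4:
  assumes f: "lin i 3 f" and cyc: "\<And>x. x \<in> F i \<Longrightarrow> d 3 (f x) = 0"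
  shows "lin i 4 (\<lambda>x. inv4 (f x))"
proof (rule linI)
  note inv4_f = inv4[OF lin_in[OF f] cyc]
  fix x y assume "x \<in> F i" "y \<in> F i"
  then show "inv4 (f (x + y)) = inv4 (f x) + inv4 (f y)"
    by (intro inv4_eqI) (simp_all add: F_closed d_rules lin_rules[OF f] inv4_f)
next
  note inv4_f = inv4[OF lin_in[OF f] cyc]
  fix r x assume "x \<in> F i"
  then show "inv4 (f (r *s x)) = r *s inv4 (f x)"
    by (intro inv4_eqI) (simp_all add: F_closed d_rules lin_rules[OF f] inv4_f)
qed (simp add: inv4 lin_in[OF f] cyc)

lemma bil_inv4:
  assumes "bil i j 3 f" "\<And>x y. \<lbrakk>x \<in> F i; y \<in> F j\<rbrakk> \<Longrightarrow> d 3 (f x y) = 0"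
  shows "bil i j 4 (\<lambda>x y. inv4 (f x y))"
  using assms by (intro bilI lin_inv4) (auto intro: bil_left bil_right)

lemma F4_generator:
  assumes "\<exists>f. module_iso (*) UNIV scale (F 4) f"
  obtains \<theta> where "\<theta> \<in> F 4" "\<And>t. t \<in> F 4 \<Longrightarrow> \<exists>r. t = r *s \<theta>"
    "\<And>r s. r *s \<theta> = s *s \<theta> \<Longrightarrow> r = s"
proof -
  obtain g where g: "module_iso (*) UNIV scale (F 4) g"
    using assms by blast
  have "g (r * 1) = r *s g 1" for r
    using g unfolding module_iso_def linear_between_def by blast
  then have g_eq: "g r = r *s g 1" for r
    by (metis mult.right_neutral)
  show ?thesis
  proof (rule that)
    show "g 1 \<in> F 4"
      using g unfolding module_iso_def linear_between_def by auto
    show "\<exists>r. t = r *s g 1" if "t \<in> F 4" for t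
      using g that g_eq unfolding module_iso_def bij_betw_def by (metis imageE)
    show "r = s" if "r *s g 1 = s *s g 1" for r s
      using g that unfolding module_iso_def bij_betw_def inj_on_def by (metis g_eq UNIV_I)
  qed
qed

lemma F4_endomorphism:
  assumes F4: "\<exists>f. module_iso (*) UNIV scale (F 4) f" and f: "lin 4 4 f"
  shows "\<exists>!r. \<forall>t\<in>F 4. f t = r *s t"
proof -
  obtain \<theta> where \<theta>: "\<theta> \<in> F 4" and gen: "\<And>t. t \<in> F 4 \<Longrightarrow> \<exists>r. t = r *s \<theta>"
    and inj: "\<And>r s. r *s \<theta> = s *s \<theta> \<Longrightarrow> r = s"
    using F4_generator[OF F4] by blast
  obtain r where r: "f \<theta> = r *s \<theta>"
    using gen lin_in[OF f \<theta>] by blast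
  have "f t = r *s t" if "t \<in> F 4" for t
    using gen[OF that] lin_scale[OF f \<theta>] r by (auto simp: mult.commute)
  moreover have "s = r" if "\<forall>t\<in>F 4. f t = s *s t" for s
    using that \<theta> r inj by metis
  ultimately show ?thesis by blast
qed

lemma rank_one_iso:
  assumes "free_of_rank scale (F 4) 1"
  shows "\<exists>f. module_iso (*) UNIV scale (F 4) f"
proof -
  obtain \<theta> where ind: "\<not> dependent {\<theta>}" and span: "span {\<theta>} = F 4"
    using assms unfolding free_of_rank_def by (metis card_1_singletonE)
  have "r = s" if "r *s \<theta> = s *s \<theta>" for r s
    using independentD[OF ind, of "{\<theta>}" "\<lambda>_. r - s" \<theta>] that
    by (simp add: scale_left_diff_distrib)
  then have "module_iso (*) UNIV scale (F 4) (\<lambda>r. r *s \<theta>)"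
    using span unfolding module_iso_def linear_between_def bij_betw_def inj_on_def span_singleton
    by (auto simp: scale_left_distrib)
  then show ?thesis by blast
qed

text \<open>
The map \<open>F j \<rightarrow> Hom (F i, F 4)\<close> is the dual of the isomorphism \<open>F i \<rightarrow> Hom (F j, F 4)\<close>, up to the
identification of \<open>F j\<close> with its double dual, which is available because \<open>F j\<close> is free and \<open>F 4\<close>
has a generator \<open>\<theta>\<close>. Concretely, the elements \<open>a k\<close> of \<open>F i\<close> in the proof represent the
coordinate functions of \<open>F j\<close>.
\<close>

lemma transpose_perfect:
  assumes F4: "\<exists>f. module_iso (*) UNIV scale (F 4) f"
    and p: "bil i j 4 p"
    and perfect: "\<And>f. lin j 4 f \<Longrightarrow> \<exists>!x. x \<in> F i \<and> (\<forall>y\<in>F j. p x y = f y)"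
    and f: "lin i 4 f"
  shows "\<exists>!y. y \<in> F j \<and> (\<forall>x\<in>F i. p x y = f x)"
proof -
  obtain \<theta> where \<theta>: "\<theta> \<in> F 4" and gen: "\<And>t. t \<in> F 4 \<Longrightarrow> \<exists>r. t = r *s \<theta>"
    and inj: "\<And>r s. r *s \<theta> = s *s \<theta> \<Longrightarrow> r = s"
    using F4_generator[OF F4] by blast
  obtain n b Y where Y: "coordinates j n b Y"
    using coordinates_exist by blast
  note b = coord_in[OF Y]
  have "lin j 4 (\<lambda>y. Y k y *s \<theta>)" if "k < n" for k
    using that \<theta> by (intro linI) (simp_all add: F_scale coord_add[OF Y] coord_scale[OF Y]
        scale_left_distrib)
  then have "\<forall>k. \<exists>x. k < n \<longrightarrow> x \<in> F i \<and> (\<forall>y\<in>F j. p x y = Y k y *s \<theta>)"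
    using perfect by blast
  then obtain a where a: "\<And>k. k < n \<Longrightarrow> a k \<in> F i"
    and pa: "\<And>k y. \<lbrakk>k < n; y \<in> F j\<rbrakk> \<Longrightarrow> p (a k) y = Y k y *s \<theta>"
    by metis
  have "\<forall>k. \<exists>r. k < n \<longrightarrow> f (a k) = r *s \<theta>"
    using gen lin_in[OF f a] by blast
  then obtain r where r: "\<And>k. k < n \<Longrightarrow> f (a k) = r k *s \<theta>"
    by metis
  define y where "y = (\<Sum>k<n. r k *s b k)"
  have y: "y \<in> F j"
    unfolding y_def using b by (intro F_sum F_scale) simp
  show ?thesis
  proof (rule ex1I)
    have "p x y = f x" if x: "x \<in> F i" for x
    proof -
      have "\<forall>k. \<exists>s. k < n \<longrightarrow> p x (b k) = s *s \<theta>"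
        using gen bil_in[OF p x b] by blast
      then obtain s where s: "\<And>k. k < n \<Longrightarrow> p x (b k) = s k *s \<theta>"
        by metis
      define x' where "x' = (\<Sum>k<n. s k *s a k)"
      have x': "x' \<in> F i"
        unfolding x'_def using a by (intro F_sum F_scale) simp
      have "p x' z = p x z" if z: "z \<in> F j" for z
      proof -
        have "p x' z = (\<Sum>k<n. s k *s p (a k) z)"
          unfolding x'_def using a by (intro lin_combination[OF bil_left[OF p z]]) simp
        also have "\<dots> = (\<Sum>k<n. Y k z *s p x (b k))"
          using z by (intro sum.cong) (simp_all add: pa s mult.commute)
        also have "\<dots> = p x (\<Sum>k<n. Y k z *s b k)"
          using b by (intro lin_combination[OF bil_right[OF p x], symmetric]) simp
        finally show ?thesis
          using coord_expand[OF Y z] by simp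
      qed
      then have "x' = x"
        using perfect[OF bil_right[OF p x]] x x' by blast
      then have "f x = (\<Sum>k<n. s k *s f (a k))"
        unfolding x'_def using lin_combination[OF f, of "{..<n}" a s] a by auto
      also have "\<dots> = (\<Sum>k<n. r k *s p x (b k))"
        by (intro sum.cong) (simp_all add: r s mult.commute)
      also have "\<dots> = p x y"
        unfolding y_def using b by (intro lin_combination[OF bil_right[OF p x], symmetric]) simp
      finally show ?thesis by simp
    qed
    with y show "y \<in> F j \<and> (\<forall>x\<in>F i. p x y = f x)" by blast
    fix z assume z: "z \<in> F j \<and> (\<forall>x\<in>F i. p x z = f x)"
    have "Y k z = r k" if "k < n" for k
      using z a[OF that] pa[OF that, of z] r[OF that] inj by metis
    then show "z = y"
      unfolding y_def using coord_expand[OF Y, of z] z by simp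
  qed
qed

end

section \<open>The pairing of degrees one and three given by the self-duality\<close>

text \<open>
What the construction of the multiplication takes from the self-duality of \<open>F\<close>: the pairing
which is to become the product of \<open>F 1\<close> and \<open>F 3\<close>, and the exactness of \<open>Hom (F, F 4)\<close> at the
duals of \<open>F 3\<close>, \<open>F 2\<close> and \<open>F 1\<close>.
\<close>

locale dual_pairing = length_four_resolution scale F d e
  for scale :: "'p::comm_ring_1 \<Rightarrow> 'm::ab_group_add \<Rightarrow> 'm" (infixr \<open>*s\<close> 75)
    and F :: "int \<Rightarrow> 'm set" and d :: "int \<Rightarrow> 'm \<Rightarrow> 'm" and e :: 'm +
  fixes pr :: "'m \<Rightarrow> 'm \<Rightarrow> 'm"
  assumes pr_bil: "bil 1 3 4 pr"
    and pr_d: "\<lbrakk>x \<in> F 1; t \<in> F 4\<rbrakk> \<Longrightarrow> pr x (d 4 t) = aug x *s t"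
    and pr_perfect1: "lin 3 4 f \<Longrightarrow> \<exists>!x. x \<in> F 1 \<and> (\<forall>\<xi>\<in>F 3. pr x \<xi> = f \<xi>)"
    and pr_perfect3: "lin 1 4 f \<Longrightarrow> \<exists>!\<xi>. \<xi> \<in> F 3 \<and> (\<forall>x\<in>F 1. pr x \<xi> = f x)"
    and F4_iso: "\<exists>f. module_iso (*) UNIV scale (F 4) f"
    and dual_exact3: "\<lbrakk>lin 3 4 f; \<And>t. t \<in> F 4 \<Longrightarrow> f (d 4 t) = 0\<rbrakk> \<Longrightarrow>
      \<exists>g. lin 2 4 g \<and> (\<forall>\<xi>\<in>F 3. f \<xi> = g (d 3 \<xi>))"
    and dual_exact2: "\<lbrakk>lin 2 4 f; \<And>\<xi>. \<xi> \<in> F 3 \<Longrightarrow> f (d 3 \<xi>) = 0\<rbrakk> \<Longrightarrow>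
      \<exists>g. lin 1 4 g \<and> (\<forall>v\<in>F 2. f v = g (d 2 v))"
    and dual_exact1: "\<lbrakk>lin 1 4 f; \<And>v. v \<in> F 2 \<Longrightarrow> f (d 2 v) = 0\<rbrakk> \<Longrightarrow>
      \<exists>t\<in>F 4. \<forall>x\<in>F 1. f x = aug x *s t"

locale self_dual_resolution = length_four_resolution scale F d e
  for scale :: "'p::comm_ring_1 \<Rightarrow> 'm::ab_group_add \<Rightarrow> 'm" (infixr \<open>*s\<close> 75)
    and F :: "int \<Rightarrow> 'm set" and d :: "int \<Rightarrow> 'm \<Rightarrow> 'm" and e :: 'm +
  fixes \<phi> :: "int \<Rightarrow> 'm \<Rightarrow> 'm \<Rightarrow> 'm"
  assumes F4_iso: "\<exists>f. module_iso (*) UNIV scale (F 4) f"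
    and \<phi>_iso: "module_iso scale (F i) (Hom_scale scale) (dual_modules scale F 4 i) (\<phi> i)"
    and \<phi>_chain: "x \<in> F i \<Longrightarrow> \<phi> (i - 1) (d i x) = dual_diff F d 4 i (\<phi> i x)"
begin

lemma \<phi>_bil: "bil i (4 - i) 4 (\<phi> i)"
proof (rule bilI)
  have L: "linear_between scale (F i) (Hom_scale scale) (dual_modules scale F 4 i) (\<phi> i)"
    using \<phi>_iso unfolding module_iso_def by blast
  then show R: "lin (4 - i) 4 (\<phi> i x)" if "x \<in> F i" for x
    using that unfolding linear_between_def[of _ "F i"] dual_modules_def Hom_def by blast
  show "lin i 4 (\<lambda>x. \<phi> i x y)" if "y \<in> F (4 - i)" for y
    using that L lin_in[OF R] unfolding linear_between_def[of _ "F i"]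
    by (auto simp: Hom_scale_def)
qed

lemma \<phi>_perfect:
  assumes f: "lin (4 - i) 4 f"
  shows "\<exists>!x. x \<in> F i \<and> (\<forall>y\<in>F (4 - i). \<phi> i x y = f y)"
proof -
  have bij: "bij_betw (\<phi> i) (F i) (Hom scale (F (4 - i)) (F 4))"
    using \<phi>_iso unfolding module_iso_def dual_modules_def by blast
  have "lin (4 - i) 4 (extend0 (F (4 - i)) f)"
    by (rule linI) (simp_all add: extend0_def F_closed lin_rules[OF f])
  then have "extend0 (F (4 - i)) f \<in> Hom scale (F (4 - i)) (F 4)"
    unfolding Hom_def by (simp add: extend0_def)
  then obtain x where x: "x \<in> F i" "\<phi> i x = extend0 (F (4 - i)) f"
    using bij unfolding bij_betw_def by (metis imageE)
  show ?thesis
  proof (rule ex1I)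
    show "x \<in> F i \<and> (\<forall>y\<in>F (4 - i). \<phi> i x y = f y)"
      using x by (simp add: extend0_def)
    fix z assume z: "z \<in> F i \<and> (\<forall>y\<in>F (4 - i). \<phi> i z y = f y)"
    then have "\<phi> i z \<in> Hom scale (F (4 - i)) (F 4)"
      using bij unfolding bij_betw_def by blast
    then have "\<phi> i z = \<phi> i x"
      using z x(2) unfolding Hom_def extend0_def by auto
    then show "z = x"
      using bij z x(1) unfolding bij_betw_def inj_on_def by blast
  qed
qed

lemma \<phi>_adjoint: "\<lbrakk>x \<in> F i; y \<in> F (5 - i)\<rbrakk> \<Longrightarrow> \<phi> (i - 1) (d i x) y = \<phi> i x (d (5 - i) y)"
  using \<phi>_chain[of x i] by (simp add: dual_diff_def extend0_def)

text \<open>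
A functional \<open>f\<close> is \<open>\<phi> (4 - j) x\<close> for some \<open>x\<close>, and \<open>x\<close> is a cycle if \<open>f\<close> vanishes on the image
of \<open>d\<close>. Then \<open>x = d u\<close>, and \<open>f\<close> is the composition of \<open>\<phi> (5 - j) u\<close> with \<open>d\<close>.
\<close>

lemma dual_exact:
  assumes j: "j < 4" and f: "lin j 4 f"
    and cocycle: "\<And>y. y \<in> F (j + 1) \<Longrightarrow> f (d (j + 1) y) = 0"
  shows "\<exists>g. lin (j - 1) 4 g \<and> (\<forall>y\<in>F j. f y = g (d j y))"
proof -
  obtain x where x: "x \<in> F (4 - j)" and fx: "\<And>y. y \<in> F j \<Longrightarrow> \<phi> (4 - j) x y = f y"
    using \<phi>_perfect[of "4 - j" f] f by auto
  have dx: "d (4 - j) x \<in> F (3 - j)"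
    using lin_in[OF lin_d x] by simp
  have "\<phi> (3 - j) (d (4 - j) x) y = 0" if y: "y \<in> F (j + 1)" for y
  proof -
    have "d (j + 1) y \<in> F j"
      using lin_in[OF lin_d y] by simp
    then show ?thesis
      using \<phi>_adjoint[OF x, of y] fx cocycle[OF y] y by (simp add: algebra_simps)
  qed
  moreover have "\<phi> (3 - j) 0 y = 0" if "y \<in> F (j + 1)" for y
    using lin_zero[OF bil_left[OF \<phi>_bil, of y "3 - j"]] that by (simp add: algebra_simps)
  moreover have "\<exists>!z. z \<in> F (3 - j) \<and> (\<forall>y\<in>F (j + 1). \<phi> (3 - j) z y = 0)"
  proof -
    have "4 - (3 - j) = j + 1"
      by simp
    then show ?thesis
      using \<phi>_perfect[OF lin_zero_map, of "3 - j"] by (simp add: add.commute)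
  qed
  ultimately have "d (4 - j) x = 0"
    using dx F_zero[of "3 - j"] by blast
  then have "x \<in> {x \<in> F (4 - j). d (4 - j) x = 0}"
    using x by simp
  then obtain u where u: "u \<in> F (5 - j)" "d (5 - j) u = x"
    using exact[of "4 - j"] j by (auto simp: algebra_simps)
  have "f y = \<phi> (5 - j) u (d j y)" if "y \<in> F j" for y
    using \<phi>_adjoint[OF u(1), of y] u(2) fx[OF that] that by simp
  moreover have "lin (j - 1) 4 (\<phi> (5 - j) u)"
    using bil_right[OF \<phi>_bil u(1)] by (simp add: algebra_simps)
  ultimately show ?thesis by blast
qed

text \<open>
In degree \<open>0\<close> the isomorphism \<open>\<phi>\<close> sends \<open>e\<close> to multiplication by some \<open>r\<close> on \<open>F 4\<close>, and it is
surjective, so that \<open>r\<close> has an inverse \<open>c\<close>. Multiplying \<open>\<phi>\<close> by \<open>c\<close> makes \<open>e\<close> act as the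
identity.
\<close>

lemma exists_dual_pairing: "\<exists>pr. dual_pairing scale F d e pr"
proof -
  have "\<exists>!x. x \<in> F 0 \<and> (\<forall>t\<in>F 4. \<phi> 0 x t = t)"
    using \<phi>_perfect[of 0 "\<lambda>t. t"] lin_id by simp
  then obtain x0 where x0: "x0 \<in> F 0" "\<And>t. t \<in> F 4 \<Longrightarrow> \<phi> 0 x0 t = t"
    by blast
  define c where "c = coeff x0"
  have \<phi>0: "bil 0 4 4 (\<phi> 0)" and \<phi>1: "bil 1 3 4 (\<phi> 1)"
    using \<phi>_bil[of 0] \<phi>_bil[of 1] by simp_all
  have c: "c *s \<phi> 0 e t = t" if "t \<in> F 4" for t
    using bil_rules(3)[OF \<phi>0 that e_in, of c] x0(2)[OF that] scale_coeff[OF x0(1)]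
    unfolding c_def by simp
  obtain r where r: "\<And>t. t \<in> F 4 \<Longrightarrow> \<phi> 0 e t = r *s t"
    using F4_endomorphism[OF F4_iso bil_right[OF \<phi>0 e_in]] by blast
  have cr: "c *s r *s t = t" if "t \<in> F 4" for t
    using c[OF that] r[OF that] by simp
  have rc: "r *s c *s t = t" if "t \<in> F 4" for t
    using cr[OF that] by (simp add: mult.commute)
  define pr where "pr x \<xi> = c *s \<phi> 1 x \<xi>" for x \<xi>
  have pr_bil: "bil 1 3 4 pr"
    unfolding pr_def[abs_def] using bil_left[OF \<phi>1] bil_right[OF \<phi>1]
    by (intro bilI lin_scale_map) auto
  have pr_perfect: "\<exists>!x. x \<in> F 1 \<and> (\<forall>\<xi>\<in>F 3. pr x \<xi> = f \<xi>)" if f: "lin 3 4 f" for f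
  proof -
    have "\<exists>!x. x \<in> F 1 \<and> (\<forall>\<xi>\<in>F 3. \<phi> 1 x \<xi> = r *s f \<xi>)"
      using \<phi>_perfect[of 1 "\<lambda>\<xi>. r *s f \<xi>"] lin_scale_map[OF f] by simp
    moreover have "pr x \<xi> = f \<xi> \<longleftrightarrow> \<phi> 1 x \<xi> = r *s f \<xi>" if "x \<in> F 1" "\<xi> \<in> F 3" for x \<xi>
      unfolding pr_def using cr[OF lin_in[OF f that(2)]] rc[OF bil_in[OF \<phi>1 that]] by metis
    then have "x \<in> F 1 \<and> (\<forall>\<xi>\<in>F 3. pr x \<xi> = f \<xi>) \<longleftrightarrow> x \<in> F 1 \<and> (\<forall>\<xi>\<in>F 3. \<phi> 1 x \<xi> = r *s f \<xi>)" for x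
      by blast
    ultimately show ?thesis
      by simp
  qed
  have "dual_pairing scale F d e pr"
  proof unfold_locales
    show "\<exists>f. module_iso (*) UNIV scale (F 4) f"
      by (rule F4_iso)
    show "bil 1 3 4 pr"
      by (rule pr_bil)
    show "pr x (d 4 t) = aug x *s t" if x: "x \<in> F 1" and t: "t \<in> F 4" for x t
    proof -
      have "pr x (d 4 t) = c *s \<phi> 0 (aug x *s e) t"
        unfolding pr_def using \<phi>_adjoint[OF x, of t] t d1_aug[OF x] by simp
      also have "\<dots> = aug x *s t"
        using bil_rules(3)[OF \<phi>0 t e_in] c[OF t] by (metis scale_left_commute)
      finally show ?thesis .
    qed
    show "\<exists>!x. x \<in> F 1 \<and> (\<forall>\<xi>\<in>F 3. pr x \<xi> = f \<xi>)" if "lin 3 4 f" for f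
      using that by (rule pr_perfect)
    show "\<exists>!\<xi>. \<xi> \<in> F 3 \<and> (\<forall>x\<in>F 1. pr x \<xi> = f x)" if "lin 1 4 f" for f
      using F4_iso pr_bil pr_perfect that by (rule transpose_perfect)
    show "\<exists>g. lin 2 4 g \<and> (\<forall>\<xi>\<in>F 3. f \<xi> = g (d 3 \<xi>))"
      if "lin 3 4 f" "\<And>t. t \<in> F 4 \<Longrightarrow> f (d 4 t) = 0" for f
      using dual_exact[of 3 f] that by simp
    show "\<exists>g. lin 1 4 g \<and> (\<forall>v\<in>F 2. f v = g (d 2 v))"
      if "lin 2 4 f" "\<And>\<xi>. \<xi> \<in> F 3 \<Longrightarrow> f (d 3 \<xi>) = 0" for f
      using dual_exact[of 2 f] that by simp
    show "\<exists>t\<in>F 4. \<forall>x\<in>F 1. f x = aug x *s t"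
      if "lin 1 4 f" "\<And>v. v \<in> F 2 \<Longrightarrow> f (d 2 v) = 0" for f
    proof -
      have "\<exists>g. lin 0 4 g \<and> (\<forall>x\<in>F 1. f x = g (d 1 x))"
        using dual_exact[of 1 f] that by simp
      then obtain g where g: "lin 0 4 g" and fg: "\<And>x. x \<in> F 1 \<Longrightarrow> f x = g (d 1 x)"
        by blast
      have "f x = aug x *s g e" if "x \<in> F 1" for x
        using fg[OF that] d1_aug[OF that] lin_scale[OF g e_in] by simp
      then show ?thesis
        using lin_in[OF g e_in] by blast
    qed
  qed
  then show ?thesis by blast
qed

end

section \<open>Products of degree at most three\<close>

text \<open>
The products \<open>m11\<close> and \<open>m12\<close> of \<open>F 1\<close> with \<open>F 1\<close> and with \<open>F 2\<close>. The assumptions \<open>d_m11\<close>,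
\<open>d_m12\<close> and \<open>m12_d\<close> are the Leibniz rule, the last one for the product \<open>pr\<close> of \<open>F 1\<close> and \<open>F 3\<close>;
the assumption \<open>m12_m11_alt\<close> is the one from which associativity will follow.
\<close>

locale associative_products = dual_pairing scale F d e pr
  for scale :: "'p::comm_ring_1 \<Rightarrow> 'm::ab_group_add \<Rightarrow> 'm" (infixr \<open>*s\<close> 75)
    and F :: "int \<Rightarrow> 'm set" and d :: "int \<Rightarrow> 'm \<Rightarrow> 'm" and e :: 'm and pr :: "'m \<Rightarrow> 'm \<Rightarrow> 'm" +
  fixes m11 m12 :: "'m \<Rightarrow> 'm \<Rightarrow> 'm"
  assumes m11_bil: "bil 1 1 2 m11"
    and m12_bil: "bil 1 2 3 m12"
    and m11_alt: "x \<in> F 1 \<Longrightarrow> m11 x x = 0"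
    and d_m11: "\<lbrakk>x \<in> F 1; y \<in> F 1\<rbrakk> \<Longrightarrow> d 2 (m11 x y) = aug x *s y - aug y *s x"
    and d_m12: "\<lbrakk>x \<in> F 1; v \<in> F 2\<rbrakk> \<Longrightarrow> d 3 (m12 x v) = aug x *s v - m11 x (d 2 v)"
    and m12_d: "\<lbrakk>x \<in> F 1; \<xi> \<in> F 3\<rbrakk> \<Longrightarrow> m12 x (d 3 \<xi>) = aug x *s \<xi> - d 4 (pr x \<xi>)"
    and m12_m11_alt: "\<lbrakk>x \<in> F 1; y \<in> F 1\<rbrakk> \<Longrightarrow> m12 x (m11 x y) = 0"

context dual_pairing
begin

lemma exists_product_1_1:
  "\<exists>\<mu>. bil 1 1 2 \<mu> \<and> (\<forall>x\<in>F 1. \<mu> x x = 0) \<and>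
     (\<forall>x\<in>F 1. \<forall>y\<in>F 1. d 2 (\<mu> x y) = aug x *s y - aug y *s x)"
proof (rule alternating_bilinear_lift)
  show "bil 1 1 (2 - 1) (\<lambda>x y. aug x *s y - aug y *s x)"
    using bil_minus[OF bil_aug_left bil_aug_right] by simp
  show "aug x *s y - aug y *s x \<in> d 2 ` F 2" if "x \<in> F 1" "y \<in> F 1" for x y
    using that by (intro exact1) (simp_all add: aug_rules F_closed mult.commute)
qed simp

text \<open>
A first lift \<open>m0\<close> satisfies the Leibniz rule in degree \<open>3\<close> and induces a pairing \<open>\<pi>0\<close> of \<open>F 1\<close>
and \<open>F 3\<close>. Since \<open>\<pi>0\<close> and \<open>pr\<close> agree on the image of \<open>d 4\<close>, their difference is \<open>h x (d 3 \<xi>)\<close>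
for a bilinear \<open>h\<close>, and adding the cycles \<open>d 4 (h x v)\<close> to \<open>m0 x v\<close> replaces \<open>\<pi>0\<close> by \<open>pr\<close>.
\<close>

lemma exists_product_1_2:
  assumes \<mu>: "bil 1 1 2 \<mu>"
    and d\<mu>: "\<And>x y. \<lbrakk>x \<in> F 1; y \<in> F 1\<rbrakk> \<Longrightarrow> d 2 (\<mu> x y) = aug x *s y - aug y *s x"
  shows "\<exists>m. bil 1 2 3 m \<and>
    (\<forall>x\<in>F 1. \<forall>v\<in>F 2. d 3 (m x v) = aug x *s v - \<mu> x (d 2 v)) \<and>
    (\<forall>x\<in>F 1. \<forall>\<xi>\<in>F 3. m x (d 3 \<xi>) = aug x *s \<xi> - d 4 (pr x \<xi>))"
proof -
  have "bil 1 2 (3 - 1) (\<lambda>x v. aug x *s v - \<mu> x (d 2 v))"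
    using bil_minus[OF bil_aug_left bil_compose_right[OF \<mu> d2]] by simp
  moreover have "aug x *s v - \<mu> x (d 2 v) \<in> d 3 ` F 3" if "x \<in> F 1" "v \<in> F 2" for x v
    using that by (intro exact2) (simp_all add: F_closed d_rules d\<mu> aug_rules bil_rules[OF \<mu>])
  ultimately obtain m0 where m0: "bil 1 2 3 m0"
    and dm0: "\<And>x v. \<lbrakk>x \<in> F 1; v \<in> F 2\<rbrakk> \<Longrightarrow> d 3 (m0 x v) = aug x *s v - \<mu> x (d 2 v)"
    using bilinear_lift[of 1 2 3] by blast
  define \<pi>0 where "\<pi>0 x \<xi> = inv4 (aug x *s \<xi> - m0 x (d 3 \<xi>))" for x \<xi>
  have cyc: "d 3 (aug x *s \<xi> - m0 x (d 3 \<xi>)) = 0" if "x \<in> F 1" "\<xi> \<in> F 3" for x \<xi>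
    using that by (simp add: F_closed d_rules bil_rules[OF m0] bil_rules[OF \<mu>] dm0 d_d_3)
  have bc: "bil 1 3 3 (\<lambda>x \<xi>. aug x *s \<xi> - m0 x (d 3 \<xi>))"
    by (rule bil_minus[OF bil_aug_left bil_compose_right[OF m0 d3]])
  have \<pi>0: "bil 1 3 4 \<pi>0"
    unfolding \<pi>0_def using bil_inv4[OF bc cyc] by simp
  have d\<pi>0: "d 4 (\<pi>0 x \<xi>) = aug x *s \<xi> - m0 x (d 3 \<xi>)" if "x \<in> F 1" "\<xi> \<in> F 3" for x \<xi>
    unfolding \<pi>0_def using that bil_in[OF bc] by (intro inv4(2) cyc) auto
  obtain n b X where X: "coordinates 1 n b X"
    using coordinates_exist by blast
  have "\<exists>g. lin 2 4 g \<and> (\<forall>\<xi>\<in>F 3. \<pi>0 x \<xi> - pr x \<xi> = g (d 3 \<xi>))" if x: "x \<in> F 1" for x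
  proof (rule dual_exact3)
    show "lin 3 4 (\<lambda>\<xi>. \<pi>0 x \<xi> - pr x \<xi>)"
      by (rule lin_minus[OF bil_right[OF \<pi>0 x] bil_right[OF pr_bil x]])
    show "\<pi>0 x (d 4 t) - pr x (d 4 t) = 0" if t: "t \<in> F 4" for t
    proof -
      have "d 4 (\<pi>0 x (d 4 t)) = d 4 (aug x *s t)"
        using x t by (simp add: d\<pi>0 d_rules d_d_4 bil_rules[OF m0])
      then have "\<pi>0 x (d 4 t) = aug x *s t"
        using x t by - (rule d4_inj, simp_all add: F_closed bil_rules[OF \<pi>0] d_rules)
      then show ?thesis
        using x t by (simp add: pr_d)
    qed
  qed
  then have "\<forall>p. \<exists>g. p < n \<longrightarrow> lin 2 4 g \<and> (\<forall>\<xi>\<in>F 3. \<pi>0 (b p) \<xi> - pr (b p) \<xi> = g (d 3 \<xi>))"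
    using coord_in[OF X] by blast
  then obtain g where g: "\<And>p. p < n \<Longrightarrow> lin 2 4 (g p)"
    and gd: "\<And>p \<xi>. \<lbrakk>p < n; \<xi> \<in> F 3\<rbrakk> \<Longrightarrow> \<pi>0 (b p) \<xi> - pr (b p) \<xi> = g p (d 3 \<xi>)"
    by metis
  define h where "h x v = (\<Sum>p<n. X p x *s g p v)" for x v
  have h: "bil 1 2 4 h"
  proof (rule bilI)
    show "lin 1 4 (\<lambda>x. h x v)" if "v \<in> F 2" for v
      unfolding h_def using that g by (intro lin_coord_combination[OF X]) (rule lin_in)
    show "lin 2 4 (h x)" if "x \<in> F 1" for x
      unfolding h_def using g
      by (intro lin_sum_map lin_scale_map) simp
  qed
  have hd: "h x (d 3 \<xi>) = \<pi>0 x \<xi> - pr x \<xi>" if x: "x \<in> F 1" and \<xi>: "\<xi> \<in> F 3" for x \<xi>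
  proof -
    have "h x (d 3 \<xi>) = (\<Sum>p<n. X p x *s (\<pi>0 (b p) \<xi> - pr (b p) \<xi>))"
      unfolding h_def using gd \<xi> by simp
    also have "\<dots> = \<pi>0 (\<Sum>p<n. X p x *s b p) \<xi> - pr (\<Sum>p<n. X p x *s b p) \<xi>"
      using lin_combination[OF bil_left[OF \<pi>0 \<xi>], of "{..<n}" b "\<lambda>p. X p x"]
        lin_combination[OF bil_left[OF pr_bil \<xi>], of "{..<n}" b "\<lambda>p. X p x"] coord_in[OF X]
      by (simp add: scale_right_diff_distrib sum_subtractf)
    finally show ?thesis
      using coord_expand[OF X x] by simp
  qed
  define m where "m x v = m0 x v + d 4 (h x v)" for x v
  have "bil 1 2 3 m"
    unfolding m_def by (rule bil_plus[OF m0 bil_compose[OF h d4]])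
  moreover have "d 3 (m x v) = aug x *s v - \<mu> x (d 2 v)" if "x \<in> F 1" "v \<in> F 2" for x v
    unfolding m_def using that
    by (simp add: d_rules d_d_4 bil_rules[OF m0] bil_rules[OF h] dm0)
  moreover have "m x (d 3 \<xi>) = aug x *s \<xi> - d 4 (pr x \<xi>)" if "x \<in> F 1" "\<xi> \<in> F 3" for x \<xi>
    unfolding m_def using that
    by (simp add: d_rules hd d\<pi>0 bil_rules[OF \<pi>0] bil_rules[OF pr_bil])
  ultimately show ?thesis by blast
qed

text \<open>
The failure of \<open>m x (\<mu> y z)\<close> to be alternating in \<open>x\<close>, \<open>y\<close> and \<open>z\<close> is measured by cycles, that
is by elements \<open>\<rho> x y z\<close> of \<open>F 4\<close>. Since \<open>pr\<close> is perfect, \<open>\<rho>\<close> can be written as \<open>pr x (\<nu> y z)\<close>,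
and \<open>\<nu>\<close> is the correction to be made to \<open>\<mu>\<close> and \<open>m\<close>.
\<close>

lemma exists_associative_products:
  "\<exists>m11 m12. associative_products scale F d e pr m11 m12"
proof -
  obtain \<mu> where \<mu>: "bil 1 1 2 \<mu>" and \<mu>_alt: "\<And>x. x \<in> F 1 \<Longrightarrow> \<mu> x x = 0"
    and d\<mu>: "\<And>x y. \<lbrakk>x \<in> F 1; y \<in> F 1\<rbrakk> \<Longrightarrow> d 2 (\<mu> x y) = aug x *s y - aug y *s x"
    using exists_product_1_1 by blast
  obtain m where m: "bil 1 2 3 m"
    and dm: "\<And>x v. \<lbrakk>x \<in> F 1; v \<in> F 2\<rbrakk> \<Longrightarrow> d 3 (m x v) = aug x *s v - \<mu> x (d 2 v)"
    and md: "\<And>x \<xi>. \<lbrakk>x \<in> F 1; \<xi> \<in> F 3\<rbrakk> \<Longrightarrow> m x (d 3 \<xi>) = aug x *s \<xi> - d 4 (pr x \<xi>)"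
    using exists_product_1_2[OF \<mu> d\<mu>] by blast
  have \<mu>_swap: "\<mu> y x = - \<mu> x y" if "x \<in> F 1" "y \<in> F 1" for x y
    using \<mu>_alt[of "x + y"] that \<mu>_alt[of x] \<mu>_alt[of y]
    by (simp add: bil_rules[OF \<mu>] F_closed eq_neg_iff_add_eq_0 add.commute)
  \<comment> \<open>The Koszul relation: for a Leibniz multiplication \<open>G x y z\<close> would be \<open>d (x y z)\<close>.\<close>
  define G where "G x y z = aug x *s \<mu> y z - aug y *s \<mu> x z + aug z *s \<mu> x y" for x y z
  have G: "tril 1 (3 - 1) G"
    unfolding tril_def G_def
    by (intro conjI ballI bilI linI)
      (auto simp: bil_rules[OF \<mu>] F_closed aug_rules scale_left_distrib scale_right_distrib
        scale_right_diff_distrib algebra_simps)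
  have "\<exists>H. tril 1 3 H \<and> (\<forall>x\<in>F 1. \<forall>y\<in>F 1. H x x y = 0 \<and> H x y y = 0) \<and>
    (\<forall>x\<in>F 1. \<forall>y\<in>F 1. \<forall>z\<in>F 1. d 3 (H x y z) = G x y z)"
  proof (rule alternating_trilinear_lift[OF G])
    show "G x x y = 0 \<and> G x y y = 0" if "x \<in> F 1" "y \<in> F 1" for x y
      using that by (simp add: G_def \<mu>_alt)
    show "G x y z \<in> d 3 ` F 3" if "x \<in> F 1" "y \<in> F 1" "z \<in> F 1" for x y z
    proof -
      have "d 2 (G x y z) = 0"
        using that by (simp add: G_def d_rules F_closed bil_rules[OF \<mu>] d\<mu> algebra_simps
            scale_right_diff_distrib)
      moreover have "G x y z \<in> F 2"
        using that by (simp add: G_def F_closed bil_rules[OF \<mu>])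
      ultimately show ?thesis
        using exact2 by blast
    qed
  qed
  then obtain H where H: "tril 1 3 H"
    and H_alt: "\<And>x y. \<lbrakk>x \<in> F 1; y \<in> F 1\<rbrakk> \<Longrightarrow> H x x y = 0"
    and dH: "\<And>x y z. \<lbrakk>x \<in> F 1; y \<in> F 1; z \<in> F 1\<rbrakk> \<Longrightarrow> d 3 (H x y z) = G x y z"
    and H_alt': "\<And>x y. \<lbrakk>x \<in> F 1; y \<in> F 1\<rbrakk> \<Longrightarrow> H x y y = 0"
    by blast
  have HB: "bil 1 1 3 (H x)" if "x \<in> F 1" for x
    using H that unfolding tril_def by auto
  have HL: "lin 1 3 (\<lambda>x. H x y z)" if "y \<in> F 1" "z \<in> F 1" for y z
    using H that unfolding tril_def by auto
  \<comment> \<open>By the Leibniz rule both terms have the differential \<open>G x y z\<close>.\<close>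
  have cyc: "d 3 (m x (\<mu> y z) - H x y z) = 0" if "x \<in> F 1" "y \<in> F 1" "z \<in> F 1" for x y z
    using that by (simp add: d_rules bil_rules[OF m] bil_rules[OF \<mu>] bil_rules[OF HB] F_closed
        dH dm G_def d\<mu> \<mu>_swap[of _ x])
  have in3: "m x (\<mu> y z) - H x y z \<in> F 3" if "x \<in> F 1" "y \<in> F 1" "z \<in> F 1" for x y z
    using that by (simp add: bil_rules[OF m] bil_rules[OF \<mu>] bil_rules[OF HB] F_closed)
  define \<rho> where "\<rho> x y z = inv4 (m x (\<mu> y z) - H x y z)" for x y z
  have \<rho>_in: "\<rho> x y z \<in> F 4" and d\<rho>: "d 4 (\<rho> x y z) = m x (\<mu> y z) - H x y z"
    if "x \<in> F 1" "y \<in> F 1" "z \<in> F 1" for x y z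
    unfolding \<rho>_def using inv4[OF in3 cyc] that by auto
  have \<rho>_lin: "lin 1 4 (\<lambda>x. \<rho> x y z)" if "y \<in> F 1" "z \<in> F 1" for y z
    unfolding \<rho>_def using that
    by (intro lin_inv4 cyc lin_minus bil_left[OF m] HL) (auto simp: bil_rules[OF \<mu>])
  have \<rho>_bil: "bil 1 1 4 (\<rho> x)" if "x \<in> F 1" for x
    unfolding \<rho>_def using that
    by (intro bil_inv4 cyc bil_minus bil_compose[OF \<mu> bil_right[OF m]] HB)
  have \<rho>_alt: "\<rho> x y y = 0" if "x \<in> F 1" "y \<in> F 1" for x y
    using that by - (rule d4_eq_0, simp_all add: \<rho>_in d\<rho> \<mu>_alt H_alt' bil_rules[OF m])
  define \<nu> where "\<nu> y z = (THE \<xi>. \<xi> \<in> F 3 \<and> (\<forall>x\<in>F 1. pr x \<xi> = \<rho> x y z))" for y z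
  have \<nu>: "\<nu> y z \<in> F 3" "\<And>x. x \<in> F 1 \<Longrightarrow> pr x (\<nu> y z) = \<rho> x y z"
    if "y \<in> F 1" "z \<in> F 1" for y z
    unfolding \<nu>_def using theI'[OF pr_perfect3[OF \<rho>_lin[OF that]]] by auto
  have pr_cancel: "\<xi> = \<zeta>" if "\<xi> \<in> F 3" "\<zeta> \<in> F 3" "\<And>x. x \<in> F 1 \<Longrightarrow> pr x \<xi> = pr x \<zeta>" for \<xi> \<zeta>
    using pr_perfect3[OF bil_left[OF pr_bil that(2)]] that by blast
  have \<nu>_bil: "bil 1 1 3 \<nu>"
    by (intro bilI linI; (rule pr_cancel)?;
        simp add: \<nu> F_closed bil_rules[OF \<rho>_bil] bil_rules[OF pr_bil])
  have \<nu>_alt: "\<nu> y y = 0" if "y \<in> F 1" for y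
    using that by - (rule pr_cancel, simp_all add: \<nu> \<rho>_alt bil_rules[OF pr_bil])
  define m11 where "m11 x y = \<mu> x y + d 3 (\<nu> x y)" for x y
  define m12 where "m12 x v = m x v - \<nu> x (d 2 v)" for x v
  have "associative_products scale F d e pr m11 m12"
  proof unfold_locales
    show "bil 1 1 2 m11"
      unfolding m11_def by (rule bil_plus[OF \<mu> bil_compose[OF \<nu>_bil d3]])
    show "bil 1 2 3 m12"
      unfolding m12_def by (rule bil_minus[OF m bil_compose_right[OF \<nu>_bil d2]])
    show "m11 x x = 0" if "x \<in> F 1" for x
      using that by (simp add: m11_def \<mu>_alt \<nu>_alt d_rules)
    show "d 2 (m11 x y) = aug x *s y - aug y *s x" if "x \<in> F 1" "y \<in> F 1" for x y
      using that by (simp add: m11_def d_rules bil_rules[OF \<mu>] d\<mu> d_d_3 \<nu>)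
    show "d 3 (m12 x v) = aug x *s v - m11 x (d 2 v)" if "x \<in> F 1" "v \<in> F 2" for x v
      using that by (simp add: m11_def m12_def d_rules bil_rules[OF m] dm \<nu>)
    show "m12 x (d 3 \<xi>) = aug x *s \<xi> - d 4 (pr x \<xi>)" if "x \<in> F 1" "\<xi> \<in> F 3" for x \<xi>
      using that by (simp add: m12_def md d_d_3 bil_rules[OF \<nu>_bil])
    show "m12 x (m11 x y) = 0" if x: "x \<in> F 1" and y: "y \<in> F 1" for x y
    proof -
      have "m12 x (m11 x y) = m x (\<mu> x y) + m x (d 3 (\<nu> x y)) - \<nu> x (aug x *s y - aug y *s x)"
        using x y by (simp add: m11_def m12_def bil_rules[OF m] bil_rules[OF \<mu>] d_rules \<nu> d_d_3 d\<mu>)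
      also have "m x (\<mu> x y) = d 4 (\<rho> x x y)"
        using x y by (simp add: d\<rho> H_alt)
      also have "m x (d 3 (\<nu> x y)) = aug x *s \<nu> x y - d 4 (\<rho> x x y)"
        using x y by (simp add: md \<nu>)
      also have "\<nu> x (aug x *s y - aug y *s x) = aug x *s \<nu> x y"
        using x y by (simp add: bil_rules[OF \<nu>_bil] F_closed \<nu>_alt)
      finally show ?thesis by simp
    qed
  qed
  then show ?thesis by blast
qed

end

section \<open>The remaining products and the divided square\<close>

context associative_products
begin

lemmas m_rules = bil_rules[OF m11_bil] bil_rules[OF m12_bil] bil_rules[OF pr_bil]

lemma m11_swap: "\<lbrakk>x \<in> F 1; y \<in> F 1\<rbrakk> \<Longrightarrow> m11 y x = - m11 x y"
  using m11_alt[of "x + y"] m11_alt[of x] m11_alt[of y]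
  by (simp add: m_rules F_closed eq_neg_iff_add_eq_0 add.commute)

lemma m12_m11_swap:
  assumes "x \<in> F 1" "y \<in> F 1" "z \<in> F 1"
  shows "m12 y (m11 x z) = - m12 x (m11 y z)"
  using assms m12_m11_alt[of "x + y" z] m12_m11_alt[of x z] m12_m11_alt[of y z]
  by (simp add: m_rules F_closed eq_neg_iff_add_eq_0 add.commute)

text \<open>
Being alternating in its last two and in its first two arguments, \<open>m12 x (m11 y z)\<close> is invariant
under cyclic permutations. This is associativity for three elements of degree \<open>1\<close>.
\<close>

lemma m12_m11_rotate:
  assumes "x \<in> F 1" "y \<in> F 1" "z \<in> F 1"
  shows "m12 z (m11 x y) = m12 x (m11 y z)"
  using assms m12_m11_swap[of x z y] m11_swap[of y z] by (simp add: m_rules)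

text \<open>
The Leibniz rule and the injectivity of \<open>d 4\<close> leave no choice for the product \<open>m22\<close> of two
elements of degree \<open>2\<close>, nor for the divided square \<open>dsq\<close>.
\<close>

definition m22 :: "'m \<Rightarrow> 'm \<Rightarrow> 'm" where
  "m22 v w = inv4 (m12 (d 2 v) w + m12 (d 2 w) v)"

definition dsq :: "'m \<Rightarrow> 'm" where
  "dsq v = inv4 (m12 (d 2 v) v)"

lemma m12_d2_cycle:
  assumes "v \<in> F 2" "w \<in> F 2"
  shows "d 3 (m12 (d 2 v) w + m12 (d 2 w) v) = 0"
  using assms m11_swap[of "d 2 v" "d 2 w"]
  by (simp add: d_rules m_rules d_m12 aug_rules)

lemma m22_bil: "bil 2 2 4 m22"
proof -
  have "bil 2 2 3 (\<lambda>v w. m12 (d 2 v) w)"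
    by (rule bil_compose_left[OF m12_bil d2])
  then have "bil 2 2 3 (\<lambda>v w. m12 (d 2 v) w + m12 (d 2 w) v)"
    using bil_plus bil_flip by blast
  then show ?thesis
    unfolding m22_def[abs_def] by (rule bil_inv4) (rule m12_d2_cycle)
qed

lemma d_m22: "\<lbrakk>v \<in> F 2; w \<in> F 2\<rbrakk> \<Longrightarrow> d 4 (m22 v w) = m12 (d 2 v) w + m12 (d 2 w) v"
  unfolding m22_def by (intro inv4(2) m12_d2_cycle F_add) (simp_all add: m_rules d_rules)

lemma dsq_in: "v \<in> F 2 \<Longrightarrow> dsq v \<in> F 4"
  and d_dsq: "v \<in> F 2 \<Longrightarrow> d 4 (dsq v) = m12 (d 2 v) v"
  unfolding dsq_def
  by (simp_all add: inv4 d_m12 m_rules d_rules aug_rules m11_alt)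

lemmas m22_rules = bil_rules[OF m22_bil]

lemma dsq_eqI: "\<lbrakk>v \<in> F 2; t \<in> F 4; d 4 t = m12 (d 2 v) v\<rbrakk> \<Longrightarrow> dsq v = t"
  unfolding dsq_def by (rule inv4_eqI)

lemma m22_eqI: "\<lbrakk>v \<in> F 2; w \<in> F 2; t \<in> F 4; d 4 t = m12 (d 2 v) w + m12 (d 2 w) v\<rbrakk> \<Longrightarrow> m22 v w = t"
  unfolding m22_def by (rule inv4_eqI)

lemma m22_commute: "m22 v w = m22 w v"
  unfolding m22_def by (simp add: add.commute)

lemma dsq_add: "\<lbrakk>v \<in> F 2; w \<in> F 2\<rbrakk> \<Longrightarrow> dsq (v + w) = dsq v + m22 v w + dsq w"
  by (rule dsq_eqI) (simp_all add: F_closed dsq_in m22_rules d_rules d_dsq d_m22 m_rules)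

lemma dsq_scale: "v \<in> F 2 \<Longrightarrow> dsq (r *s v) = (r * r) *s dsq v"
  by (rule dsq_eqI) (simp_all add: F_closed dsq_in d_rules d_dsq m_rules)

lemma m22_same: "v \<in> F 2 \<Longrightarrow> m22 v v = dsq v + dsq v"
  by (rule m22_eqI) (simp_all add: F_closed dsq_in d_rules d_dsq)

lemma dsq_m11: "\<lbrakk>x \<in> F 1; y \<in> F 1\<rbrakk> \<Longrightarrow> dsq (m11 x y) = 0"
  using m12_m11_swap[of x y y]
  by - (rule dsq_eqI, simp_all add: d_rules d_m11 m_rules F_closed m12_m11_alt m11_alt)

text \<open>
Associativity for elements of degrees \<open>1\<close>, \<open>1\<close> and \<open>2\<close>. After an application of \<open>d 4\<close> both sides
are expanded by the Leibniz rule, and the difference is the associativity in degree \<open>3\<close>.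
\<close>

lemma m22_m11: "\<lbrakk>x \<in> F 1; y \<in> F 1; v \<in> F 2\<rbrakk> \<Longrightarrow> m22 (m11 x y) v = pr x (m12 y v)"
proof (rule m22_eqI)
  assume x: "x \<in> F 1" and y: "y \<in> F 1" and v: "v \<in> F 2"
  have "d 4 (pr x (m12 y v)) = aug x *s m12 y v - m12 x (aug y *s v - m11 y (d 2 v))"
    using m12_d[of x "m12 y v"] x y v by (simp add: m_rules d_m12)
  also have "\<dots> = aug x *s m12 y v - aug y *s m12 x v + m12 (d 2 v) (m11 x y)"
    using m12_m11_rotate[of x y "d 2 v"] x y v
    by (simp add: m_rules F_closed d_rules)
  finally show "d 4 (pr x (m12 y v)) = m12 (d 2 (m11 x y)) v + m12 (d 2 v) (m11 x y)"
    using x y v by (simp add: d_m11 m_rules F_closed)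
qed (simp_all add: m_rules)

lemma pr_m12_swap: "\<lbrakk>x \<in> F 1; y \<in> F 1; v \<in> F 2\<rbrakk> \<Longrightarrow> pr y (m12 x v) = - pr x (m12 y v)"
  using m22_m11[of x y v] m22_m11[of y x v] m11_swap[of x y] by (simp add: m22_rules m_rules)

text \<open>
The Leibniz rule for degrees \<open>2\<close> and \<open>3\<close>, whose left-hand side \<open>d 5 0\<close> vanishes.
\<close>

lemma m22_d: "\<lbrakk>v \<in> F 2; \<xi> \<in> F 3\<rbrakk> \<Longrightarrow> m22 v (d 3 \<xi>) = - pr (d 2 v) \<xi>"
  by (rule m22_eqI) (simp_all add: d_rules m_rules F_closed d_d_3 m12_d aug_rules)

section \<open>The graded algebra with divided powers\<close>

text \<open>
An element of \<open>F 0\<close> acts as the corresponding scalar. The sign in degrees \<open>(3, 1)\<close> is the one of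
graded commutativity.
\<close>

definition mul :: "int \<Rightarrow> int \<Rightarrow> 'm \<Rightarrow> 'm \<Rightarrow> 'm" where
  "mul i j x y =
    (if i = 0 then coeff x *s y else if j = 0 then coeff y *s x
     else if i = 1 \<and> j = 1 then m11 x y else if i = 1 \<and> j = 2 then m12 x y
     else if i = 2 \<and> j = 1 then m12 y x else if i = 1 \<and> j = 3 then pr x y
     else if i = 3 \<and> j = 1 then - pr y x else if i = 2 \<and> j = 2 then m22 x y else 0)"

lemma mul_simps:
  "mul 0 j x y = coeff x *s y"
  "mul 1 1 x y = m11 x y" "mul 1 2 x y = m12 x y" "mul 2 1 x y = m12 y x"
  "mul 1 3 x y = pr x y" "mul 3 1 x y = - pr y x" "mul 2 2 x y = m22 x y"
  by (simp_all add: mul_def)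

lemma mul_0_right: "\<lbrakk>x \<in> F i; y \<in> F 0\<rbrakk> \<Longrightarrow> mul i 0 x y = coeff y *s x"
  unfolding mul_def using scale_coeff[of x] scale_coeff[of y]
  by (auto simp: scale_left_commute) (metis scale_left_commute)

lemma mul_eq_0:
  "\<lbrakk>i \<noteq> 0; j \<noteq> 0; \<not> (0 < i \<and> 0 < j \<and> i + j \<le> 4)\<rbrakk> \<Longrightarrow> mul i j x y = 0"
  unfolding mul_def by auto

lemma mul_bil: "bil i j (i + j) (mul i j)"
proof -
  have "(i = 0) \<or> (i \<noteq> 0 \<and> j = 0) \<or> (i = 1 \<and> j = 1) \<or> (i = 1 \<and> j = 2)
         \<or> (i = 2 \<and> j = 1) \<or> (i = 1 \<and> j = 3) \<or> (i = 3 \<and> j = 1)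
         \<or> (i = 2 \<and> j = 2)
         \<or> (i \<noteq> 0 \<and> j \<noteq> 0 \<and> \<not> (0 < i \<and> 0 < j \<and> i + j \<le> 4))"
    by presburger
  then consider "i = 0" | "i \<noteq> 0" "j = 0" | "i = 1" "j = 1" | "i = 1" "j = 2" | "i = 2" "j = 1"
    | "i = 1" "j = 3" | "i = 3" "j = 1" | "i = 2" "j = 2"
    | "i \<noteq> 0" "j \<noteq> 0" "\<not> (0 < i \<and> 0 < j \<and> i + j \<le> 4)"
    by blast
  then show ?thesis
  proof cases
    case 1
    then show ?thesis
      using bil_coeff_left unfolding mul_def[abs_def] by simp
  next
    case 2
    then show ?thesis
      using bil_coeff_right unfolding mul_def[abs_def] by simp
  next
    case 9
    then have "mul i j = (\<lambda>x y. 0)"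
      using mul_eq_0 by blast
    then show ?thesis
      using bil_zero by simp
  qed (use m11_bil m12_bil bil_flip[OF m12_bil] pr_bil bil_uminus[OF bil_flip[OF pr_bil]] m22_bil
      in \<open>simp_all add: mul_def[abs_def]\<close>)
qed

lemmas mul_rules = bil_rules[OF mul_bil]

lemma F_trivial: "\<lbrakk>x \<in> F i; i < 0 \<or> 4 < i\<rbrakk> \<Longrightarrow> x = 0"
  using F_neg[of i] F_above[of i] by auto

text \<open>
Apart from scalar factors and zero modules, only four combinations of degrees have a total of at
most \<open>4\<close>; each is one of the identities already proved.
\<close>

lemma mul_associative:
  assumes x: "x \<in> F i" and y: "y \<in> F j" and z: "z \<in> F k"
  shows "mul (i + j) k (mul i j x y) z = mul i (j + k) x (mul j k y z)"
proof -
  have L: "mul (i + j) k (mul i j x y) z \<in> F (i + j + k)"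
    using x y z by (simp add: mul_rules)
  have R: "mul i (j + k) x (mul j k y z) \<in> F (i + j + k)"
    using mul_rules(1)[OF x mul_rules(1)[OF y z]] by (simp add: add.assoc)
  have "(i = 0) \<or> (j = 0) \<or> (k = 0) \<or> ((i < 0 \<or> j < 0 \<or> k < 0)) \<or> (4 < i + j + k)
         \<or> (i = 1 \<and> j = 1 \<and> k = 1) \<or> (i = 1 \<and> j = 1 \<and> k = 2)
         \<or> (i = 1 \<and> j = 2 \<and> k = 1) \<or> (i = 2 \<and> j = 1 \<and> k = 1)"
    by presburger
  then consider "i = 0" | "j = 0" | "k = 0" | "i < 0 \<or> j < 0 \<or> k < 0" | "4 < i + j + k"
    | "i = 1" "j = 1" "k = 1" | "i = 1" "j = 1" "k = 2" | "i = 1" "j = 2" "k = 1"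
    | "i = 2" "j = 1" "k = 1"
    by blast
  then show ?thesis
  proof cases
    case 1
    then show ?thesis
      using x y z by (simp add: mul_simps mul_rules)
  next
    case 2
    then show ?thesis
      using x y z by (simp add: mul_simps mul_rules mul_0_right)
  next
    case 3
    then show ?thesis
      using x y z by (simp add: mul_0_right mul_rules)
  next
    case 4
    then have "x = 0 \<or> y = 0 \<or> z = 0"
      using x y z F_trivial by blast
    then show ?thesis
      using x y z by (elim disjE; simp add: mul_rules)
  next
    case 5
    then show ?thesis
      using F_trivial[OF L] F_trivial[OF R] by simp
  next
    case 6
    then show ?thesis
      using x y z m12_m11_rotate by (simp add: mul_simps)
  next
    case 7
    then show ?thesis
      using x y z by (simp add: mul_simps m22_m11)
  next
    case 8
    then show ?thesis
      using x y z by (simp add: mul_simps pr_m12_swap[of x z y])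
  next
    case 9
    then show ?thesis
      using x y z pr_m12_swap[of y z x] by (simp add: mul_simps m22_commute[of x] m22_m11 m_rules)
  qed
qed

text \<open>
The total degree \<open>5\<close> has to be considered here, since its differential would lie in \<open>F 4\<close>.
\<close>

lemma mul_leibniz:
  assumes x: "x \<in> F i" and y: "y \<in> F j"
  shows "d (i + j) (mul i j x y) =
    mul (i - 1) j (d i x) y + (if even i then 1 else - 1) *s mul i (j - 1) x (d j y)"
proof -
  note dx = lin_in[OF lin_d x] and dy = lin_in[OF lin_d y]
  have L: "d (i + j) (mul i j x y) \<in> F (i + j - 1)"
    using lin_in[OF lin_d mul_rules(1)[OF x y]] .
  have R: "mul (i - 1) j (d i x) y + (if even i then 1 else - 1) *s mul i (j - 1) x (d j y)
      \<in> F (i + j - 1)"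
    using mul_rules(1)[OF dx y] mul_rules(1)[OF x dy]
    by (intro F_add F_scale) (simp_all add: algebra_simps)
  have "(i = 0) \<or> (j = 0) \<or> ((i < 0 \<or> j < 0)) \<or> (5 < i + j) \<or> (i = 1 \<and> j = 1)
         \<or> (i = 1 \<and> j = 2) \<or> (i = 2 \<and> j = 1) \<or> (i = 1 \<and> j = 3)
         \<or> (i = 3 \<and> j = 1) \<or> (i = 2 \<and> j = 2) \<or> (i = 1 \<and> j = 4)
         \<or> (i = 4 \<and> j = 1) \<or> (i = 2 \<and> j = 3) \<or> (i = 3 \<and> j = 2)"
    by presburger
  then consider "i = 0" | "j = 0" | "i < 0 \<or> j < 0" | "5 < i + j"
    | "i = 1" "j = 1" | "i = 1" "j = 2" | "i = 2" "j = 1" | "i = 1" "j = 3" | "i = 3" "j = 1"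
    | "i = 2" "j = 2" | "i = 1" "j = 4" | "i = 4" "j = 1" | "i = 2" "j = 3" | "i = 3" "j = 2"
    by blast
  then show ?thesis
  proof cases
    case 1
    then have "d i x = 0"
      using dx F_trivial[of "d i x" "- 1"] by simp
    with 1 show ?thesis
      using x y by (simp add: mul_simps mul_rules lin_rules[OF lin_d])
  next
    case 2
    then have "d j y = 0"
      using dy F_trivial[of "d j y" "- 1"] by simp
    with 2 show ?thesis
      using x y dx by (simp add: mul_0_right mul_rules lin_rules[OF lin_d])
  next
    case 3
    then have "x = 0 \<or> y = 0"
      using x y F_trivial by blast
    then show ?thesis
      using x y dx dy by (elim disjE; simp add: mul_rules lin_zero[OF lin_d])
  next
    case 4
    then show ?thesis
      using F_trivial[OF L] F_trivial[OF R] by simp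
  next
    case 5
    then show ?thesis
      using x y d_rules by (simp add: mul_simps mul_0_right d_m11 aug_def)
  next
    case 6
    then show ?thesis
      using x y d_rules by (simp add: mul_simps d_m12 aug_def)
  next
    case 7
    then show ?thesis
      using x y m11_swap[of y "d 2 x"] by (simp add: mul_simps mul_0_right d_m12 d_rules flip: aug_def)
  next
    case 8
    then show ?thesis
      using x y by (simp add: mul_simps m12_d flip: aug_def)
  next
    case 9
    then show ?thesis
      using x y by (simp add: mul_simps mul_0_right m12_d d_rules m_rules flip: aug_def)
  next
    case 10
    then show ?thesis
      using x y by (simp add: mul_simps d_m22)
  next
    case 11
    then show ?thesis
      using x y by (simp add: mul_simps mul_eq_0 pr_d lin_zero[OF lin_d] flip: aug_def)
  next
    case 12
    then show ?thesis
      using x y by (simp add: mul_simps mul_0_right mul_eq_0 pr_d lin_zero[OF lin_d] d_rules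
          flip: aug_def)
  next
    case 13
    then show ?thesis
      using x y by (simp add: mul_simps mul_eq_0 m22_d lin_zero[OF lin_d])
  next
    case 14
    then show ?thesis
      using x y by (simp add: mul_simps mul_eq_0 m22_commute[of "d 3 x"] m22_d lin_zero[OF lin_d])
  qed
qed

lemma mul_graded_commute:
  assumes x: "x \<in> F i" and y: "y \<in> F j"
  shows "mul i j x y = (if even (i * j) then 1 else - 1) *s mul j i y x"
proof -
  have "(i = 0) \<or> (j = 0) \<or> (i = 1 \<and> j = 1) \<or> (i = 1 \<and> j = 2) \<or> (i = 2 \<and> j = 1)
         \<or> (i = 1 \<and> j = 3) \<or> (i = 3 \<and> j = 1) \<or> (i = 2 \<and> j = 2)
         \<or> (i \<noteq> 0 \<and> j \<noteq> 0 \<and> \<not> (0 < i \<and> 0 < j \<and> i + j \<le> 4))"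
    by presburger
  then consider "i = 0" | "j = 0" | "i = 1" "j = 1" | "i = 1" "j = 2" | "i = 2" "j = 1"
    | "i = 1" "j = 3" | "i = 3" "j = 1" | "i = 2" "j = 2"
    | "i \<noteq> 0" "j \<noteq> 0" "\<not> (0 < i \<and> 0 < j \<and> i + j \<le> 4)"
    by blast
  then show ?thesis
  proof cases
    case 9
    then have "mul i j x y = 0" "mul j i y x = 0"
      by (auto intro: mul_eq_0)
    then show ?thesis by simp
  qed (use x y in \<open>simp_all add: mul_simps mul_0_right m11_swap[of x y] m22_commute[of x]\<close>)
qed

sublocale dg: dg_algebra scale F d e mul
proof unfold_locales
  show "mul (i + j) k (mul i j x y) z = mul i (j + k) x (mul j k y z)"
    if "x \<in> F i" "y \<in> F j" "z \<in> F k" for i j k x y z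
    using that by (rule mul_associative)
  show "d (i + j) (mul i j x y) =
      mul (i - 1) j (d i x) y + (if even i then 1 else - 1) *s mul i (j - 1) x (d j y)"
    if "x \<in> F i" "y \<in> F j" for i j x y
    using that by (rule mul_leibniz)
  show "mul i j x y = (if even (i * j) then 1 else - 1) *s mul j i y x"
    if "x \<in> F i" "y \<in> F j" for i j x y
    using that by (rule mul_graded_commute)
  show "linear_between (*s) (F i) (*s) (F (i + j)) (\<lambda>x. mul i j x y)" if "y \<in> F j" for y i j
    using bil_left[OF mul_bil that] .
  show "linear_between (*s) (F j) (*s) (F (i + j)) (mul i j x)" if "x \<in> F i" for x i j
    using bil_right[OF mul_bil that] .
  show "mul i i x x = 0" if "odd i" "x \<in> F i" for i x
  proof (cases "i = 1")
    case False
    then have "i < 0 \<or> 3 \<le> i"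
      using that(1) by presburger
    then show ?thesis
      using that by (intro mul_eq_0) auto
  qed (use that in \<open>simp add: mul_simps m11_alt\<close>)
qed (simp_all add: mul_simps mul_0_right)

text \<open>
The only divided power beyond exponent \<open>1\<close> which is not forced to vanish by its degree is the
square of an element of degree \<open>2\<close>.
\<close>

definition dpow :: "int \<Rightarrow> nat \<Rightarrow> 'm \<Rightarrow> 'm" where
  "dpow i k x =
    (if k = 0 then e else if k = 1 then x else if i = 2 \<and> k = 2 then dsq x else 0)"

lemma dpow_simps:
  "dpow i 0 x = e" "dpow i 1 x = x" "dpow i (Suc 0) x = x" "dpow 2 2 x = dsq x"
  by (simp_all add: dpow_def)

lemma dpow_in: "x \<in> F i \<Longrightarrow> dpow i k x \<in> F (i * int k)"
  unfolding dpow_def by (auto simp: dsq_in)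

text \<open>
The bound is \<open>5\<close> rather than \<open>4\<close> because the Leibniz rule for divided powers takes place one
degree lower.
\<close>

lemma high_degree:
  assumes "0 < i" "even i" "2 \<le> k" "\<not> (i = 2 \<and> k = 2)"
  shows "5 < i * int k"
proof -
  have "i = 2 \<or> 4 \<le> i"
    using assms(1,2) by presburger
  then show ?thesis
  proof
    assume "i = 2"
    then show ?thesis using assms by auto
  next
    assume "4 \<le> i"
    then have "4 * 2 \<le> i * int k"
      using assms(3) by (intro mult_mono) auto
    then show ?thesis by simp
  qed
qed

lemma dpow_eq_0: "\<lbrakk>2 \<le> k; \<not> (i = 2 \<and> k = 2)\<rbrakk> \<Longrightarrow> dpow i k x = 0"
  unfolding dpow_def by auto

sublocale dg_gamma_algebra scale F d e mul dpow
proof unfold_locales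
  fix i :: int and x
  assume i: "0 < i" "even i" and x: "x \<in> F i"
  show "dpow i k x \<in> F (i * int k)" for k
    by (rule dpow_in[OF x])
  show "dpow i 0 x = e" "dpow i 1 x = x"
    by (simp_all add: dpow_simps)
  show "mul (i * int h) (i * int k) (dpow i h x) (dpow i k x) =
      of_nat (h + k choose h) *s dpow i (h + k) x" for h k
  proof -
    have dx: "dpow i k x \<in> F (i * int k)" for k
      by (rule dpow_in[OF x])
    consider "h = 0" | "k = 0" | "i = 2" "h = 1" "k = 1" | "0 < h" "0 < k" "\<not> (i = 2 \<and> h + k = 2)"
      by linarith
    then show ?thesis
    proof cases
      case 1
      then show ?thesis by (simp add: dpow_simps mul_simps)
    next
      case 2
      then show ?thesis
        using dx[of h] by (simp add: dpow_simps mul_0_right)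
    next
      case 3
      then show ?thesis
        using x m22_same[of x] scale_left_distrib[of 1 1 "dsq x"]
        by (simp add: dpow_simps mul_simps numeral_2_eq_2[symmetric])
    next
      case 4
      then have "5 < i * int (h + k)"
        using i by (intro high_degree) auto
      then have "5 < i * int h + i * int k"
        by (simp add: algebra_simps)
      then have "mul (i * int h) (i * int k) (dpow i h x) (dpow i k x) = 0"
        using F_trivial[OF mul_rules(1)[OF dx dx]] by simp
      with 4 show ?thesis
        by (simp add: dpow_eq_0)
    qed
  qed
  show "dpow i k (x + y) =
      (\<Sum>j\<le>k. mul (i * int j) (i * int (k - j)) (dpow i j x) (dpow i (k - j) y))"
    if y: "y \<in> F i" for k y
  proof -
    have dx: "dpow i j x \<in> F (i * int j)" "dpow i j y \<in> F (i * int j)" for j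
      using dpow_in x y by auto
    consider "k = 0" | "k = 1" | "i = 2" "k = 2" | "2 \<le> k" "\<not> (i = 2 \<and> k = 2)"
      by linarith
    then show ?thesis
    proof cases
      case 1
      then show ?thesis by (simp add: dpow_simps mul_simps)
    next
      case 2
      then show ?thesis
        using x y by (simp add: dpow_simps mul_simps mul_0_right add.commute)
    next
      case 3
      have "(\<Sum>j\<le>2. g j) = g 0 + g 1 + g 2" for g :: "nat \<Rightarrow> 'm"
        by (simp add: numeral_2_eq_2)
      with 3 show ?thesis
        using x y dsq_in[of x] dsq_in[of y]
        by (simp add: dpow_simps mul_simps mul_0_right dsq_add add_ac)
    next
      case 4
      have "mul (i * int j) (i * int (k - j)) (dpow i j x) (dpow i (k - j) y) = 0" if "j \<le> k" for j
      proof -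
        have "i * int j + i * int (k - j) = i * int k"
          using that by (simp add: of_nat_diff algebra_simps)
        then show ?thesis
          using F_trivial[OF mul_rules(1)[OF dx]] high_degree[OF i 4] by simp
      qed
      with 4 show ?thesis
        by (simp add: dpow_eq_0)
    qed
  qed
  show "dpow (i * int h) k (dpow i h x) =
      of_nat (fact (h * k) div (fact k * fact h ^ k)) *s dpow i (h * k) x" if h: "1 \<le> h" for h k
  proof -
    consider "k = 0" | "k = 1" | "h = 1" | "2 \<le> k" "2 \<le> h"
      using h by linarith
    then show ?thesis
    proof cases
      case 4
      have "2 * 2 \<le> i * int h"
        using i 4 by (intro mult_mono) auto
      moreover have "2 * 2 \<le> h * k"
        using 4 by (intro mult_mono) auto
      ultimately show ?thesis
        using 4 by (simp add: dpow_eq_0)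
    qed (simp_all add: dpow_simps)
  qed
  show "d (i * int k) (dpow i k x) = mul (i - 1) (i * int (k - 1)) (d i x) (dpow i (k - 1) x)"
    if k: "1 \<le> k" for k
  proof -
    note dx = lin_in[OF lin_d x]
    consider "k = 1" | "i = 2" "k = 2" | "2 \<le> k" "\<not> (i = 2 \<and> k = 2)"
      using k by linarith
    then show ?thesis
    proof cases
      case 1
      then show ?thesis
        using dx by (simp add: dpow_simps mul_0_right)
    next
      case 2
      then show ?thesis
        using x by (simp add: dpow_simps mul_simps d_dsq)
    next
      case 3
      have "i - 1 + i * int (k - 1) = i * int k - 1"
        using k by (simp add: of_nat_diff algebra_simps)
      then have "mul (i - 1) (i * int (k - 1)) (d i x) (dpow i (k - 1) x) = 0"
        using F_trivial[OF mul_rules(1)[OF dx dpow_in[OF x]]] high_degree[OF i 3] by simp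
      with 3 show ?thesis
        by (simp add: dpow_eq_0 lin_zero[OF lin_d])
    qed
  qed
next
  fix k :: nat and i j :: int and x y
  assume k: "2 \<le> k" and ij: "0 < i" "0 < j" "odd i" "odd j" and x: "x \<in> F i" and y: "y \<in> F j"
  show "dpow (i + j) k (mul i j x y) = 0"
  proof (cases "i + j = 2 \<and> k = 2")
    case True
    then have "i = 1" "j = 1" using ij by auto
    then show ?thesis
      using True x y by (simp add: dpow_simps mul_simps dsq_m11)
  next
    case False
    then show ?thesis using k by (simp add: dpow_eq_0)
  qed
next
  fix k :: nat and i j :: int and x y
  assume k: "2 \<le> k" and ij: "0 \<le> i" "0 < j" "even i" "even j" and x: "x \<in> F i" and y: "y \<in> F j"
  show "dpow (i + j) k (mul i j x y) = mul (i * int k) (j * int k) (dg.pow i k x) (dpow j k y)"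
  proof (cases "i = 0")
    case True
    have pow: "dg.pow 0 n x = coeff x ^ n *s e" for n
      by (induction n) (simp_all add: mul_simps)
    show ?thesis
    proof (cases "j = 2 \<and> k = 2")
      case True
      then show ?thesis
        using \<open>i = 0\<close> y by (simp add: dpow_simps mul_simps pow dsq_scale power2_eq_square)
    next
      case False
      then show ?thesis
        using \<open>i = 0\<close> k by (simp add: dpow_eq_0 mul_simps)
    qed
  next
    case False
    then have "2 \<le> i" "2 \<le> j"
      using ij by presburger+
    then have "2 * 2 \<le> i * int k" "2 * 2 \<le> j * int k"
      using k by (intro mult_mono; simp)+
    then have "mul (i * int k) (j * int k) (dg.pow i k x) (dpow j k y) = 0"
      using k False ij(2) by (intro mul_eq_0) simp_all
    then show ?thesis
      using k \<open>2 \<le> i\<close> \<open>2 \<le> j\<close> by (simp add: dpow_eq_0)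
  qed
qed

section \<open>Poincare duality\<close>

lemma aug_eq_0I:
  assumes "x \<in> F 1" "\<And>t. t \<in> F 4 \<Longrightarrow> aug x *s t = 0"
  shows "aug x = 0"
  using F4_endomorphism[OF F4_iso lin_zero_map] assms(2) scale_zero_left by metis

text \<open>
The five lemma, with elements. Given \<open>f\<close>, the functional \<open>f \<circ> d 3\<close> is represented by some \<open>x\<close> in
\<open>F 1\<close> through \<open>pr\<close>, and \<open>x = d 2 v\<close>. Then \<open>v\<close> represents \<open>f\<close> up to a functional which vanishes
on the image of \<open>d 3\<close>; by exactness of the dual complex that functional factors through \<open>d 2\<close>
and is represented by some \<open>d 3 \<xi>\<close>. Injectivity is proved by a similar diagram chase.
\<close>

lemma m22_perfect:
  assumes f: "lin 2 4 f"
  shows "\<exists>!v. v \<in> F 2 \<and> (\<forall>w\<in>F 2. m22 v w = f w)"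
proof (rule ex_ex1I)
  have "lin 3 4 (\<lambda>\<xi>. - f (d 3 \<xi>))"
    using lin_uminus[OF lin_compose[OF d3 f]] .
  then obtain x where x: "x \<in> F 1" and x_pr: "\<And>\<xi>. \<xi> \<in> F 3 \<Longrightarrow> pr x \<xi> = - f (d 3 \<xi>)"
    using pr_perfect1 by blast
  have "aug x *s t = 0" if "t \<in> F 4" for t
    using pr_d[OF x that] x_pr[of "d 4 t"] that by (simp add: d_rules d_d_4 lin_zero[OF f])
  then obtain v where v: "v \<in> F 2" "d 2 v = x"
    using exact1[OF x aug_eq_0I[OF x]] by blast
  have "lin 2 4 (\<lambda>w. f w - m22 v w)"
    by (rule lin_minus[OF f bil_right[OF m22_bil v(1)]])
  then have "\<exists>g. lin 1 4 g \<and> (\<forall>w\<in>F 2. f w - m22 v w = g (d 2 w))"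
    by (rule dual_exact2) (simp add: m22_d v x_pr)
  then obtain g where g: "lin 1 4 g" and fg: "\<And>w. w \<in> F 2 \<Longrightarrow> f w - m22 v w = g (d 2 w)"
    by blast
  obtain \<xi> where \<xi>: "\<xi> \<in> F 3" and \<xi>_pr: "\<And>x. x \<in> F 1 \<Longrightarrow> pr x \<xi> = g x"
    using pr_perfect3[OF g] by blast
  have "m22 (v - d 3 \<xi>) w = f w" if w: "w \<in> F 2" for w
  proof -
    have "m22 (d 3 \<xi>) w = - g (d 2 w)"
      using w \<xi> \<xi>_pr by (simp add: m22_commute[of "d 3 \<xi>"] m22_d d_rules)
    then show ?thesis
      using w \<xi> v fg[OF w] by (simp add: m22_rules d_rules algebra_simps)
  qed
  moreover have "v - d 3 \<xi> \<in> F 2"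
    using v \<xi> by (simp add: F_closed d_rules)
  ultimately show "\<exists>v. v \<in> F 2 \<and> (\<forall>w\<in>F 2. m22 v w = f w)" by blast
next
  have nondegenerate: "v = 0" if v: "v \<in> F 2" and v0: "\<And>w. w \<in> F 2 \<Longrightarrow> m22 v w = 0" for v
  proof -
    have "pr (d 2 v) \<xi> = 0" if "\<xi> \<in> F 3" for \<xi>
      using m22_d[OF v that] v0[of "d 3 \<xi>"] that by (simp add: d_rules)
    then have "d 2 v = 0"
      using pr_perfect1[OF lin_zero_map] v d_rules F_zero bil_rules(4)[OF pr_bil] by metis
    then obtain \<xi> where \<xi>: "\<xi> \<in> F 3" "v = d 3 \<xi>"
      using exact2[OF v] by blast
    have "pr (d 2 w) \<xi> = 0" if "w \<in> F 2" for w
      using m22_d[OF that \<xi>(1)] v0[OF that] \<xi>(2) m22_commute by simp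
    then obtain t where t: "t \<in> F 4" "\<And>x. x \<in> F 1 \<Longrightarrow> pr x \<xi> = aug x *s t"
      using dual_exact1[OF bil_left[OF pr_bil \<xi>(1)]] by blast
    have "d 4 t \<in> F 3" "\<And>x. x \<in> F 1 \<Longrightarrow> pr x (d 4 t) = aug x *s t"
      using t(1) by (simp_all add: d_rules pr_d)
    then have "\<xi> = d 4 t"
      using pr_perfect3[OF bil_left[OF pr_bil \<xi>(1)]] \<xi>(1) t(2) by metis
    then show ?thesis
      using \<xi>(2) t(1) by (simp add: d_d_4)
  qed
  fix v w
  assume "v \<in> F 2 \<and> (\<forall>u\<in>F 2. m22 v u = f u)" "w \<in> F 2 \<and> (\<forall>u\<in>F 2. m22 w u = f u)"
  then show "v = w"
    using nondegenerate[of "v - w"] by (simp add: F_closed m22_rules)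
qed

lemma mul_perfect_left:
  assumes f: "lin (4 - i) 4 f"
  shows "\<exists>!x. x \<in> F i \<and> (\<forall>y\<in>F (4 - i). mul i (4 - i) x y = f y)"
proof -
  consider "i < 0 \<or> 4 < i" | "i = 0" | "i = 1" | "i = 2" | "i = 3" | "i = 4"
    by linarith
  then show ?thesis
  proof cases
    case 1
    then have "F i = {0}" "F (4 - i) = {0}"
      using F_neg F_above by auto
    then show ?thesis
      using lin_zero[OF f] mul_rules(4)[of 0 "4 - i" i] by auto
  next
    case 2
    then have "lin 4 4 f"
      using f by simp
    then obtain r where r: "\<forall>t\<in>F 4. f t = r *s t" and unique: "\<And>s. \<forall>t\<in>F 4. f t = s *s t \<Longrightarrow> s = r"
      using F4_endomorphism[OF F4_iso] by blast
    have "x = r *s e" if "x \<in> F 0" "\<forall>y\<in>F 4. coeff x *s y = f y" for x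
      using unique[of "coeff x"] that scale_coeff[of x] by simp
    then show ?thesis
      using 2 r by (intro ex1I[of _ "r *s e"]) (auto simp: mul_simps F_scale)
  next
    case 3
    then show ?thesis
      using pr_perfect1 f by (simp add: mul_simps)
  next
    case 4
    then show ?thesis
      using m22_perfect f by (simp add: mul_simps)
  next
    case 5
    have "\<exists>!x. x \<in> F 3 \<and> (\<forall>y\<in>F 1. pr y x = - f y)"
      using pr_perfect3[OF lin_uminus] f 5 by simp
    moreover have "pr y x = - f y \<longleftrightarrow> mul 3 1 x y = f y" for x y
      unfolding mul_simps by (metis minus_minus)
    ultimately show ?thesis
      using 5 by simp
  next
    case 6
    have f0: "lin 0 4 f"
      using f 6 by simp
    have fe: "f e \<in> F 4"
      by (rule lin_in[OF f0 e_in])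
    have "coeff y *s f e = f y" if "y \<in> F 0" for y
      using lin_scale[OF f0 e_in] scale_coeff[OF that] by metis
    then have "mul 4 0 (f e) y = f y" if "y \<in> F 0" for y
      using mul_0_right[OF fe that] that by simp
    moreover have "x = f e" if "x \<in> F 4" "\<forall>y\<in>F 0. mul 4 0 x y = f y" for x
      using that mul_0_right[OF that(1) e_in] e_in by simp
    ultimately have "\<exists>!x. x \<in> F 4 \<and> (\<forall>y\<in>F 0. mul 4 0 x y = f y)"
      using fe by blast
    then show ?thesis
      using 6 by simp
  qed
qed

text \<open>
By graded commutativity this is the preceding lemma for the complementary degree, up to the sign
\<open>s\<close>.
\<close>

lemma mul_perfect_right:
  assumes f: "lin i 4 f"
  shows "\<exists>!y. y \<in> F (4 - i) \<and> (\<forall>x\<in>F i. mul i (4 - i) x y = f x)"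
proof -
  define s :: 'p where "s = (if even (i * (4 - i)) then 1 else - 1)"
  have s: "s * s = 1"
    by (simp add: s_def)
  have "mul i (4 - i) x y = f x \<longleftrightarrow> mul (4 - i) i y x = s *s f x"
    if "x \<in> F i" "y \<in> F (4 - i)" for x y
    using mul_graded_commute[OF that] s unfolding s_def[symmetric]
    by (metis scale_one scale_scale)
  then have "y \<in> F (4 - i) \<and> (\<forall>x\<in>F i. mul i (4 - i) x y = f x) \<longleftrightarrow>
      y \<in> F (4 - i) \<and> (\<forall>x\<in>F i. mul (4 - i) i y x = s *s f x)" for y
    by blast
  moreover have "\<exists>!y. y \<in> F (4 - i) \<and> (\<forall>x\<in>F i. mul (4 - i) i y x = s *s f x)"
    using mul_perfect_left[of "4 - i" "\<lambda>x. s *s f x"] lin_scale_map[OF f] by simp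
  ultimately show ?thesis
    by simp
qed

lemma mul_poincare_duality: "poincare_duality scale F mul"
  unfolding poincare_duality_def
proof (intro exI[of _ 4] conjI allI impI)
  show "F i = {0}" if "4 < i" for i
    using F_above that by simp
  show "\<exists>f. module_iso (*) UNIV scale (F 4) f"
    by (rule F4_iso)
  fix i
  have bil: "bil i (4 - i) 4 (mul i (4 - i))"
    using mul_bil[of i "4 - i"] by simp
  show "module_iso scale (F i) (Hom_scale scale) (Hom scale (F (4 - i)) (F 4))
      (\<lambda>x. extend0 (F (4 - i)) (\<lambda>y. mul i (4 - i) x y))"
    using perfect_pairing_iso[OF bil mul_perfect_left] by simp
  show "module_iso scale (F (4 - i)) (Hom_scale scale) (Hom scale (F i) (F 4))
      (\<lambda>y. extend0 (F i) (\<lambda>x. mul i (4 - i) x y))"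
    using perfect_pairing_iso[OF bil_flip[OF bil] mul_perfect_right] by simp
qed

end

theorem theorem4p6:
  fixes scale :: "'p::comm_ring_1 \<Rightarrow> 'm::ab_group_add \<Rightarrow> 'm"
    and F :: "int \<Rightarrow> 'm set"
    and d :: "int \<Rightarrow> 'm \<Rightarrow> 'm"
    and e :: 'm
  assumes "noetherian TYPE('p)"
    and "free_resolution scale F d e"
    and "\<And>i. 4 < i \<Longrightarrow> F i = {0}"
    and "free_of_rank scale (F 4) 1"
    and "complexes_isomorphic scale F d
           (Hom_scale scale) (dual_modules scale F 4) (dual_diff F d 4)"
  shows "\<exists>mul dpow. dg_gamma_algebra scale F d e mul dpow \<and> poincare_duality scale F mul"
proof -
  interpret length_four_resolution scale F d e
    using assms(2,3) by (intro length_four_resolution.intro length_four_resolution_axioms.intro)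
  obtain \<phi> where "\<And>i. module_iso scale (F i) (Hom_scale scale) (dual_modules scale F 4 i) (\<phi> i)"
    and "\<And>i x. x \<in> F i \<Longrightarrow> \<phi> (i - 1) (d i x) = dual_diff F d 4 i (\<phi> i x)"
    using assms(5) unfolding complexes_isomorphic_def by blast
  then interpret self_dual_resolution scale F d e \<phi>
    using rank_one_iso[OF assms(4)] by unfold_locales
  obtain pr where "dual_pairing scale F d e pr"
    using exists_dual_pairing by blast
  then interpret dual_pairing scale F d e pr .
  obtain m11 m12 where "associative_products scale F d e pr m11 m12"
    using exists_associative_products by blast
  then interpret associative_products scale F d e pr m11 m12 .
  show ?thesis
    using dg_gamma_algebra_axioms mul_poincare_duality by blast
qed

end
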